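(* Let $\mathcal{E}$ be a system of evolution equations $u_t=f(x,t,u,u_1,\dots,u_k)$. Let $\mathcal{H}_A$ be a shadow in the $\ell^*$-covering corresponding to a skew-adjoint $\mathcal{C}$-differential operator $A\colon\hat\varkappa\to\varkappa$ and let $\mathcal{N}_R$ be a shadow in the $\ell$-covering corresponding to a $\mathcal{C}$-differential operator $R\colon\varkappa\to\varkappa$. Then $$\{\mathcal{H}_A,\mathcal{N}_R\}=\mathcal{C}^*_{A,R},$$ where $\mathcal{C}^*_{A,R}$ is the function on $\mathcal{L}\mathcal{E}\times_{\mathcal{E}}\mathcal{L}^*\mathcal{E}$, bilinear in the odd variables $p$ and $q$, corresponding to the operator $C^*(A,R)\colon\hat\varkappa\times\varkappa\to\varkappa$.
   Context: Setting: $u=(u^1,\dots,u^m)$, one space variable $x$. $\mathcal{E}$ has coordinates $x,t,u^j_k$ and total derivatives $D_x=\partial_x+\sum_{j,k}u^j_{k+1}\partial_{u^j_k}$, $D_t=\partial_t+\sum_{j,k}D_x^k(f^j)\partial_{u^j_k}$; $\mathcal{F}(\mathcal{E})$ is the algebra of smooth functions in $x,t$ and finitely many $u^j_k$. $\varkappa$ and $\hat\varkappa=\mathrm{Hom}_{\mathcal{F}(\mathcal{E})}(\varkappa,\mathcal{F}(\mathcal{E})dx)$ are, in coordinates, modules of $m$-tuples of functions. $\mathcal{C}$-differential operators are matrices with entries $\sum_i a_iD_x^i$, $a_i\in\mathcal{F}(\mathcal{E})$; $*$ is the formal adjoint. $\mathcal{E}_\varphi=\sum_{j,k}D_x^k(\varphi^j)\partial_{u^j_k}$;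 $\ell_\psi(\varphi)=\mathcal{E}_\varphi(\psi)$; $\ell_{\Delta,\psi}(\varphi)=\mathcal{E}_\varphi(\Delta)(\psi)$ ($\mathcal{E}_\varphi$ acting on the coefficients of $\Delta$), with adjoint $\ell^*_{\Delta,\psi}$ in $\varphi$. The linearization of the equation is $\ell_{\mathcal{E}}=D_t-\ell_f$. The operator $C^*(A,R)$ is $$C^*(A,R)(\psi,\varphi)=-\ell_{A,\psi}(R\varphi)+\ell_{R,\varphi}(A\psi)+R(\ell_{A,\psi}(\varphi))+A\bigl(\ell^*_{R,\varphi}(\psi)-\ell_{R^*,\psi}(\varphi)\bigr),\quad\psi\in\hat\varkappa,\ \varphi\in\varkappa.$$ On $\mathcal{L}\mathcal{E}\times_{\mathcal{E}}\mathcal{L}^*\mathcal{E}$ there are, besides the coordinates on $\mathcal{E}$, odd (mutually anticommuting) variables $q^j_k,p^j_k$ ($q^j=q_0^j$, $p^j=p_0^j$) subject to $q_t=\ell_f(q)$, $p_t=-\ell_f^*(p)$, with $\tilde D_x=D_x+\sum(q^j_{k+1}\partial_{q^j_k}+p^j_{k+1}\partial_{p^j_k})$ and $\tilde D_t=D_t+\sum(\tilde D_x^k(\tilde\ell_f(q)^j)\partial_{q^j_k}-\tilde D_x^k(\tilde\ell_f^*(p)^j)\partial_{p^j_k})$. The $\ell$-covering $\mathcal{L}\mathcal{E}$ (resp. $\ell^*$-covering $\mathcal{L}^*\mathcal{E}$) uses only the $q$ (resp. only the $p$) variables. A tilde over an operator means $D_x,D_t$ are replaced by $\tilde D_x,\tilde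 D_t$; $A$, $R$ below are so lifted. For $A=\|\sum_i a^l_{ij}D_x^i\|$, $R=\|\sum_i r^l_{ij}D_x^i\|$ put $\mathcal{H}_A^l=\sum a^l_{ij}p^j_i$, $\mathcal{N}_R^l=\sum r^l_{ij}q^j_i$. They are shadows if $\tilde\ell_{\mathcal{E}}(\mathcal{H}_A)=0$, resp. $\tilde\ell_{\mathcal{E}}(\mathcal{N}_R)=0$. For a vector function $\mathcal{G}$: $\tilde\ell_{\mathcal{G}}(\chi)^l=\sum\frac{\partial\mathcal{G}^l}{\partial u^j_k}\tilde D_x^k(\chi^j)$, $\tilde\ell^*_{\mathcal{G}}(p)^j=\sum(-1)^k\tilde D_x^k\bigl(\frac{\partial\mathcal{G}^l}{\partial u^j_k}p^l\bigr)$ (factors in the order written), and $\tilde\ell_{R^*,p}(q)$ denotes $\tilde\ell_{\mathcal{G}}(q)$ for $\mathcal{G}=R^*(p)$. The bracket is $$\{\mathcal{H}_A,\mathcal{N}_R\}=-\tilde\ell_{\mathcal{N}_R}(\mathcal{H}_A)-\tilde\ell_{\mathcal{H}_A}(\mathcal{N}_R)-A\bigl(\tilde\ell^*_{\mathcal{N}_R}(p)+\tilde\ell_{R^*,p}(q)\bigr)+R(\tilde\ell_{\mathcal{H}_A}(q)).$$ Correspondence: a bilinear $\mathcal{C}$-differential operator $(\psi,\varphi)\mapsto\sum c^{ij}_{ab}D_x^i(\psi^a)D_x^j(\varphi^b)$, $\psi\in\hat\varkappa$, $\varphi\in\varkappa$, corresponds to the function $\sum c^{ij}_{ab}p^a_iq^b_j$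 (in this order). *)

theory Defs
  imports
    "HOL-Analysis.Analysis"
    "HOL-Library.Function_Algebras"
    "HOL-Library.Groups_Big_Fun"
begin

text \<open>
  The components of u are indexed by a finite linearly ordered type. The order only serves to
  choose a basis of monomials in the odd variables. Rings of functions carry the pointwise
  operations of \<^theory>\<open>HOL-Library.Function_Algebras\<close>, and \<^const>\<open>Sum_any\<close> adds up families of
  finite support; on the function algebras below all such families do have finite support.
\<close>

section \<open>Functions on the equation\<close>

datatype 'm coord = Xc | Tc | Uc 'm nat

type_synonym 'm point = "'m coord \<Rightarrow> real"
type_synonym 'm fn = "'m point \<Rightarrow> real"

definition pd :: "'m coord \<Rightarrow> 'm fn \<Rightarrow> 'm fn" where
  "pd c a = (\<lambda>z. deriv (\<lambda>s. a (z(c := s))) (z c))"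

text \<open>
  Continuity is with respect to the product topology; for a function of finitely many
  coordinates it is the usual continuity in these coordinates.
\<close>

definition smooth_fns :: "'m fn set" where
  "smooth_fns = {a.
     (\<exists>S. finite S \<and> (\<forall>z w. (\<forall>c\<in>S. z c = w c) \<longrightarrow> a z = a w)) \<and>
     (\<forall>cs. continuous_on UNIV (foldr pd cs a) \<and>
           (\<forall>c z. (\<lambda>s. foldr pd cs a (z(c := s))) differentiable (at (z c))))}"

definition u_fn :: "'m \<Rightarrow> nat \<Rightarrow> 'm fn" where
  "u_fn j k = (\<lambda>z. z (Uc j k))"

definition Dx :: "'m fn \<Rightarrow> 'm fn" where
  "Dx a = pd Xc a + Sum_any (\<lambda>(j, k). u_fn j (Suc k) * pd (Uc j k) a)"

definition Ev :: "('m \<Rightarrow> 'm fn) \<Rightarrow> 'm fn \<Rightarrow> 'm fn" where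
  "Ev \<phi> a = Sum_any (\<lambda>(j, k). (Dx ^^ k) (\<phi> j) * pd (Uc j k) a)"

definition Dt :: "('m \<Rightarrow> 'm fn) \<Rightarrow> 'm fn \<Rightarrow> 'm fn" where
  "Dt f a = pd Tc a + Ev f a"

text \<open>Elements of the modules \<open>\<kappa>\<close> and \<open>\<kappa>^\<close>, which have the same coordinate description.\<close>

definition tuples :: "('m \<Rightarrow> 'm fn) set" where
  "tuples = {\<phi>. \<forall>j. \<phi> j \<in> smooth_fns}"


section \<open>C-differential operators\<close>

text \<open>The operator with matrix entries \<open>\<Sum>\<^sub>i A l j i D\<^sub>x\<^sup>i\<close>.\<close>

type_synonym 'm cdiff = "'m \<Rightarrow> 'm \<Rightarrow> nat \<Rightarrow> 'm fn"

definition cdiff_ops :: "'m cdiff set" where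
  "cdiff_ops = {A. \<forall>l j. finite {i. A l j i \<noteq> 0} \<and> (\<forall>i. A l j i \<in> smooth_fns)}"

definition app :: "'m cdiff \<Rightarrow> ('m \<Rightarrow> 'm fn) \<Rightarrow> 'm \<Rightarrow> 'm fn" where
  "app A \<phi> l = Sum_any (\<lambda>(j, i). A l j i * (Dx ^^ i) (\<phi> j))"

text \<open>Coefficients of the scalar operator \<open>D\<^sub>x \<circ> (\<Sum>\<^sub>n b n D\<^sub>x\<^sup>n)\<close>.\<close>

definition Dx_comp :: "(nat \<Rightarrow> 'm fn) \<Rightarrow> nat \<Rightarrow> 'm fn" where
  "Dx_comp b n = Dx (b n) + (case n of 0 \<Rightarrow> 0 | Suc k \<Rightarrow> b k)"

text \<open>Transpose of the matrix, with entries \<open>(\<Sum>\<^sub>i a\<^sub>i D\<^sub>x\<^sup>i)* = \<Sum>\<^sub>i (-1)\<^sup>i D\<^sub>x\<^sup>i \<circ> a\<^sub>i\<close>.\<close>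

definition adj :: "'m cdiff \<Rightarrow> 'm cdiff" where
  "adj A j l n =
     Sum_any (\<lambda>i. (-1) ^ i * (Dx_comp ^^ i) (\<lambda>r. if r = 0 then A l j i else 0) n)"

text \<open>
  In \<open>lin_op \<Delta> \<psi> \<phi>\<close> the evolutionary field of \<open>\<phi>\<close> acts on the coefficients of \<open>\<Delta>\<close> only. The
  matrix of this C-differential operator in \<open>\<phi>\<close> is \<open>lin_mat \<Delta> \<psi>\<close>, see \<open>lin_op_eq_app_lin_mat\<close>.
\<close>

definition lin_op :: "'m cdiff \<Rightarrow> ('m \<Rightarrow> 'm fn) \<Rightarrow> ('m \<Rightarrow> 'm fn) \<Rightarrow> 'm \<Rightarrow> 'm fn" where
  "lin_op \<Delta> \<psi> \<phi> = app (\<lambda>l j i. Ev \<phi> (\<Delta> l j i)) \<psi>"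

definition lin_mat :: "'m cdiff \<Rightarrow> ('m \<Rightarrow> 'm fn) \<Rightarrow> 'm cdiff" where
  "lin_mat \<Delta> \<psi> l j k = Sum_any (\<lambda>(b, i). pd (Uc j k) (\<Delta> l b i) * (Dx ^^ i) (\<psi> b))"

lemma pd_zero [simp]: "pd c 0 = 0"
  by (simp add: pd_def fun_eq_iff)

lemma finite_pd_support:
  assumes "a \<in> smooth_fns"
  shows "finite {c. pd c a \<noteq> 0}"
proof -
  from assms obtain S where S: "finite S" "\<And>z w. (\<forall>c\<in>S. z c = w c) \<Longrightarrow> a z = a w"
    unfolding smooth_fns_def by blast
  have "pd c a = 0" if "c \<notin> S" for c
  proof -
    have "a (z(c := s)) = a z" for z s
      using that by (intro S(2)) auto
    then show ?thesis
      by (simp add: pd_def fun_eq_iff)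
  qed
  then show ?thesis
    by (intro finite_subset [OF _ S(1)]) auto
qed

lemma lin_op_eq_app_lin_mat:
  fixes \<Delta> :: "('m::finite) cdiff"
  assumes "\<Delta> \<in> cdiff_ops"
  shows "lin_op \<Delta> \<psi> \<phi> = app (lin_mat \<Delta> \<psi>) \<phi>"
proof
  fix l
  define S where "S = Sigma UNIV (\<lambda>b. {i. \<Delta> l b i \<noteq> 0})"
  define T where "T = (\<Union>s\<in>S. {t. pd (Uc (fst t) (snd t)) (\<Delta> l (fst s) (snd s)) \<noteq> 0})"
  have fin_S: "finite S"
    using assms by (simp add: S_def cdiff_ops_def)
  have "finite {t. pd (Uc (fst t) (snd t)) (\<Delta> l b i) \<noteq> 0}" for b i
  proof -
    have "\<Delta> l b i \<in> smooth_fns"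
      using assms by (simp add: cdiff_ops_def)
    moreover have "inj (\<lambda>t. Uc (fst t) (snd t) :: 'm coord)"
      by (auto simp: inj_def prod_eq_iff)
    ultimately show ?thesis
      using finite_vimageI [OF finite_pd_support] by (fastforce simp: vimage_def)
  qed
  then have fin_T: "finite T"
    using fin_S by (simp add: T_def)
  have zero_S: "\<Delta> l (fst s) (snd s) = 0" if "s \<notin> S" for s
    using that by (cases s) (auto simp: S_def)
  have zero_T: "pd (Uc (fst t) (snd t)) (\<Delta> l (fst s) (snd s)) = 0" if "t \<notin> T" for s t
    using that zero_S by (cases "s \<in> S") (auto simp: T_def)
  let ?D = "\<lambda>s t. pd (Uc (fst t) (snd t)) (\<Delta> l (fst s) (snd s))"
  let ?F = "\<lambda>t. (Dx ^^ snd t) (\<phi> (fst t))" and ?G = "\<lambda>s. (Dx ^^ snd s) (\<psi> (fst s))"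
  have Ev: "Ev \<phi> (\<Delta> l (fst s) (snd s)) = (\<Sum>t\<in>T. ?F t * ?D s t)" for s
    unfolding Ev_def case_prod_beta
  proof (intro Sum_any.expand_superset fin_T subsetI CollectI)
    fix t assume "t \<in> {t. ?F t * ?D s t \<noteq> 0}"
    then show "t \<in> T"
      using zero_T [of t s] by (cases "t \<in> T") simp_all
  qed
  have mat: "lin_mat \<Delta> \<psi> l (fst t) (snd t) = (\<Sum>s\<in>S. ?D s t * ?G s)" for t
    unfolding lin_mat_def case_prod_beta
  proof (intro Sum_any.expand_superset fin_S subsetI CollectI)
    fix s assume "s \<in> {s. ?D s t * ?G s \<noteq> 0}"
    then show "s \<in> S"
      using zero_S [of s] by (cases "s \<in> S") simp_all
  qed
  have "lin_op \<Delta> \<psi> \<phi> l = (\<Sum>s\<in>S. (\<Sum>t\<in>T. ?F t * ?D s t) * ?G s)"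
    unfolding lin_op_def app_def case_prod_beta Ev
  proof (intro Sum_any.expand_superset fin_S subsetI CollectI)
    fix s assume "s \<in> {s. (\<Sum>t\<in>T. ?F t * ?D s t) * ?G s \<noteq> 0}"
    then show "s \<in> S"
      using zero_S [of s] by (cases "s \<in> S") simp_all
  qed
  also have "\<dots> = (\<Sum>s\<in>S. \<Sum>t\<in>T. ?D s t * ?G s * ?F t)"
    by (simp only: sum_distrib_right) (simp only: ac_simps)
  also have "\<dots> = (\<Sum>t\<in>T. (\<Sum>s\<in>S. ?D s t * ?G s) * ?F t)"
    by (simp only: sum_distrib_right) (rule sum.swap)
  also have "\<dots> = app (lin_mat \<Delta> \<psi>) \<phi> l"
    unfolding app_def case_prod_beta mat
  proof (intro Sum_any.expand_superset [symmetric] fin_T subsetI CollectI)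
    fix t assume "t \<in> {t. (\<Sum>s\<in>S. ?D s t * ?G s) * ?F t \<noteq> 0}"
    then show "t \<in> T"
      using zero_T [of t] by (cases "t \<in> T") simp_all
  qed
  finally show "lin_op \<Delta> \<psi> \<phi> l = app (lin_mat \<Delta> \<psi>) \<phi> l" .
qed

definition lin_op_adj :: "'m cdiff \<Rightarrow> ('m \<Rightarrow> 'm fn) \<Rightarrow> ('m \<Rightarrow> 'm fn) \<Rightarrow> 'm \<Rightarrow> 'm fn" where
  "lin_op_adj \<Delta> \<psi> = app (adj (lin_mat \<Delta> \<psi>))"

definition Cstar ::
  "'m cdiff \<Rightarrow> 'm cdiff \<Rightarrow> ('m \<Rightarrow> 'm fn) \<Rightarrow> ('m \<Rightarrow> 'm fn) \<Rightarrow> 'm \<Rightarrow> 'm fn" where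
  "Cstar A R \<psi> \<phi> =
     - lin_op A \<psi> (app R \<phi>) + lin_op R \<phi> (app A \<psi>) + app R (lin_op A \<psi> \<phi>)
     + app A (lin_op_adj R \<phi> \<psi> - lin_op (adj R) \<psi> \<phi>)"


section \<open>Functions on the Whitney product of the two coverings\<close>

datatype 'm odd_var = Pvar 'm nat | Qvar 'm nat

instantiation odd_var :: (linorder) linorder
begin

fun less_odd_var :: "'a odd_var \<Rightarrow> 'a odd_var \<Rightarrow> bool" where
  "less_odd_var (Pvar i k) (Pvar j l) \<longleftrightarrow> k < l \<or> k = l \<and> i < j"
| "less_odd_var (Pvar i k) (Qvar j l) \<longleftrightarrow> True"
| "less_odd_var (Qvar i k) (Pvar j l) \<longleftrightarrow> False"
| "less_odd_var (Qvar i k) (Qvar j l) \<longleftrightarrow> k < l \<or> k = l \<and> i < j"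

definition less_eq_odd_var :: "'a odd_var \<Rightarrow> 'a odd_var \<Rightarrow> bool" where
  "less_eq_odd_var g h \<longleftrightarrow> g = h \<or> g < h"

instance
proof
  have irrefl: "\<not> g < g" for g :: "'a odd_var"
    by (cases g) auto
  have trans: "g < h \<Longrightarrow> h < r \<Longrightarrow> g < r" for g h r :: "'a odd_var"
    by (cases g; cases h; cases r) auto
  fix g h r :: "'a odd_var"
  show "g < h \<longleftrightarrow> g \<le> h \<and> \<not> h \<le> g"
    unfolding less_eq_odd_var_def by (metis irrefl trans)
  show "g \<le> g"
    by (simp add: less_eq_odd_var_def)
  show "g \<le> r" if "g \<le> h" "h \<le> r"
    using that unfolding less_eq_odd_var_def by (metis trans)
  show "g = h" if "g \<le> h" "h \<le> g"
    using that unfolding less_eq_odd_var_def by (metis irrefl trans)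
  show "g \<le> h \<or> h \<le> g"
    unfolding less_eq_odd_var_def by (cases g; cases h) auto
qed

end

text \<open>
  The Grassmann algebra over the functions on the equation: \<^term>\<open>F S\<close> is the coefficient at the
  product of the odd variables in the finite set \<^term>\<open>S\<close>, taken in increasing order. Its
  multiplication is \<open>gmul\<close>, not the pointwise one.
\<close>

type_synonym 'm gfun = "'m odd_var set \<Rightarrow> 'm fn"

definition gmul :: "('m::linorder) gfun \<Rightarrow> 'm gfun \<Rightarrow> 'm gfun"  (infixl \<open>\<bullet>\<^sub>g\<close> 70) where
  "F \<bullet>\<^sub>g G = (\<lambda>S. \<Sum>T\<in>Pow S.
      (-1) ^ card {(g, h). g \<in> T \<and> h \<in> S - T \<and> h < g} * (F T * G (S - T)))"

definition gconst :: "'m fn \<Rightarrow> 'm gfun" where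
  "gconst a = (\<lambda>S. if S = {} then a else 0)"

definition gen :: "'m odd_var \<Rightarrow> 'm gfun" where
  "gen g = (\<lambda>S. if S = {g} then 1 else 0)"

lemma gen_gmul_gen:
  "gen g \<bullet>\<^sub>g gen h =
     (\<lambda>S. if g \<noteq> h \<and> S = {g, h} then (if h < g then - 1 else 1) else 0)"
proof
  fix S
  let ?t = "\<lambda>T. (-1) ^ card {(x, y). x \<in> T \<and> y \<in> S - T \<and> y < x} * (gen g T * gen h (S - T))"
  have t: "?t T = 0" if "T \<noteq> {g} \<or> S - T \<noteq> {h}" for T
    using that by (auto simp: gen_def)
  show "(gen g \<bullet>\<^sub>g gen h) S = (if g \<noteq> h \<and> S = {g, h} then (if h < g then - 1 else 1) else 0)"
  proof (cases "g \<noteq> h \<and> S = {g, h}")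
    case True
    then have S: "S - {g} = {h}" "{g} \<in> Pow S" "finite (Pow S)"
      by auto
    have "(gen g \<bullet>\<^sub>g gen h) S = (\<Sum>T\<in>{{g}}. ?t T)"
      unfolding gmul_def using S t by (intro sum.mono_neutral_right) auto
    also have "{(x, y). x \<in> {g} \<and> y \<in> S - {g} \<and> y < x} = (if h < g then {(g, h)} else {})"
      using S by auto
    ultimately show ?thesis
      using True S by (simp add: gen_def)
  next
    case False
    have "?t T = 0" if "T \<in> Pow S" for T
      using that False by (intro t) auto
    then have "(gen g \<bullet>\<^sub>g gen h) S = 0"
      unfolding gmul_def by (rule sum.neutral [OF ballI])
    then show ?thesis
      using False by auto
  qed
qed

lemma gen_anticommute: "gen g \<bullet>\<^sub>g gen h = - (gen h \<bullet>\<^sub>g gen g)"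
  by (auto simp: gen_gmul_gen fun_eq_iff insert_commute)

abbreviation pvar :: "'m \<Rightarrow> nat \<Rightarrow> 'm gfun" where
  "pvar j k \<equiv> gen (Pvar j k)"

abbreviation qvar :: "'m \<Rightarrow> nat \<Rightarrow> 'm gfun" where
  "qvar j k \<equiv> gen (Qvar j k)"

definition gpd :: "'m coord \<Rightarrow> 'm gfun \<Rightarrow> 'm gfun" where
  "gpd c F = (\<lambda>S. pd c (F S))"

text \<open>The left derivative with respect to an odd variable.\<close>

definition odd_pd :: "('m::linorder) odd_var \<Rightarrow> 'm gfun \<Rightarrow> 'm gfun" where
  "odd_pd g F = (\<lambda>S. if g \<in> S then 0 else (-1) ^ card {h \<in> S. h < g} * F (insert g S))"

definition tDx :: "('m::linorder) gfun \<Rightarrow> 'm gfun" where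
  "tDx F = (\<lambda>S. Dx (F S)) +
     Sum_any (\<lambda>(j, k). qvar j (Suc k) \<bullet>\<^sub>g odd_pd (Qvar j k) F
                     + pvar j (Suc k) \<bullet>\<^sub>g odd_pd (Pvar j k) F)"

definition tlin :: "(('m::linorder) \<Rightarrow> 'm gfun) \<Rightarrow> ('m \<Rightarrow> 'm gfun) \<Rightarrow> 'm \<Rightarrow> 'm gfun" where
  "tlin G X l = Sum_any (\<lambda>(j, k). gpd (Uc j k) (G l) \<bullet>\<^sub>g (tDx ^^ k) (X j))"

definition tlin_adj :: "(('m::linorder) \<Rightarrow> 'm gfun) \<Rightarrow> ('m \<Rightarrow> 'm gfun) \<Rightarrow> 'm \<Rightarrow> 'm gfun" where
  "tlin_adj G X j =
     Sum_any (\<lambda>(l, k). (-1) ^ k * (tDx ^^ k) (gpd (Uc j k) (G l) \<bullet>\<^sub>g X l))"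

definition p_tuple :: "'m \<Rightarrow> 'm gfun" where
  "p_tuple = (\<lambda>j. pvar j 0)"

definition q_tuple :: "'m \<Rightarrow> 'm gfun" where
  "q_tuple = (\<lambda>j. qvar j 0)"

text \<open>
  The subalgebras generated by only the q or only the p variables are invariant under \<open>tDx\<close> and
  \<open>tDt\<close>, which restrict to the total derivatives of the two single coverings.
\<close>

definition tDt :: "(('m::linorder) \<Rightarrow> 'm fn) \<Rightarrow> 'm gfun \<Rightarrow> 'm gfun" where
  "tDt f F = (\<lambda>S. Dt f (F S)) +
     Sum_any (\<lambda>(j, k).
         (tDx ^^ k) (tlin (\<lambda>l. gconst (f l)) q_tuple j) \<bullet>\<^sub>g odd_pd (Qvar j k) F
       - (tDx ^^ k) (tlin_adj (\<lambda>l. gconst (f l)) p_tuple j) \<bullet>\<^sub>g odd_pd (Pvar j k) F)"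

definition tlin_E :: "(('m::linorder) \<Rightarrow> 'm fn) \<Rightarrow> ('m \<Rightarrow> 'm gfun) \<Rightarrow> 'm \<Rightarrow> 'm gfun" where
  "tlin_E f H = (\<lambda>l. tDt f (H l)) - tlin (\<lambda>l. gconst (f l)) H"

definition is_shadow :: "(('m::linorder) \<Rightarrow> 'm fn) \<Rightarrow> ('m \<Rightarrow> 'm gfun) \<Rightarrow> bool" where
  "is_shadow f H \<longleftrightarrow> tlin_E f H = 0"

definition tapp :: "('m::linorder) cdiff \<Rightarrow> ('m \<Rightarrow> 'm gfun) \<Rightarrow> 'm \<Rightarrow> 'm gfun" where
  "tapp A X l = Sum_any (\<lambda>(j, i). gconst (A l j i) \<bullet>\<^sub>g (tDx ^^ i) (X j))"

definition H_fun :: "('m::linorder) cdiff \<Rightarrow> 'm \<Rightarrow> 'm gfun" where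
  "H_fun A l = Sum_any (\<lambda>(j, i). gconst (A l j i) \<bullet>\<^sub>g pvar j i)"

definition N_fun :: "('m::linorder) cdiff \<Rightarrow> 'm \<Rightarrow> 'm gfun" where
  "N_fun R l = Sum_any (\<lambda>(j, i). gconst (R l j i) \<bullet>\<^sub>g qvar j i)"

text \<open>The bracket of \<^term>\<open>H_fun A\<close> and \<^term>\<open>N_fun R\<close>.\<close>

definition bracket :: "('m::linorder) cdiff \<Rightarrow> 'm cdiff \<Rightarrow> 'm \<Rightarrow> 'm gfun" where
  "bracket A R =
     - tlin (N_fun R) (H_fun A) - tlin (H_fun A) (N_fun R)
     - tapp A (tlin_adj (N_fun R) p_tuple + tlin (tapp (adj R) p_tuple) q_tuple)
     + tapp R (tlin (H_fun A) q_tuple)"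


section \<open>Bilinear operators and functions bilinear in p and q\<close>

text \<open>Coefficients \<open>c l a b i j\<close> at \<open>D\<^sub>x\<^sup>i(\<psi>\<^sup>a) D\<^sub>x\<^sup>j(\<phi>\<^sup>b)\<close> in the component l.\<close>

type_synonym 'm bidiff = "'m \<Rightarrow> 'm \<Rightarrow> 'm \<Rightarrow> nat \<Rightarrow> nat \<Rightarrow> 'm fn"

definition bidiff_ops :: "'m bidiff set" where
  "bidiff_ops = {c. \<forall>l a b. finite {(i, j). c l a b i j \<noteq> 0} \<and> (\<forall>i j. c l a b i j \<in> smooth_fns)}"

definition bidiff_app ::
  "'m bidiff \<Rightarrow> ('m \<Rightarrow> 'm fn) \<Rightarrow> ('m \<Rightarrow> 'm fn) \<Rightarrow> 'm \<Rightarrow> 'm fn" where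
  "bidiff_app c \<psi> \<phi> l =
     Sum_any (\<lambda>(a, b, i, j). c l a b i j * (Dx ^^ i) (\<psi> a) * (Dx ^^ j) (\<phi> b))"

definition bidiff_fun :: "('m::linorder) bidiff \<Rightarrow> 'm \<Rightarrow> 'm gfun" where
  "bidiff_fun c l =
     Sum_any (\<lambda>(a, b, i, j). gconst (c l a b i j) \<bullet>\<^sub>g pvar a i \<bullet>\<^sub>g qvar b j)"

definition has_coeffs ::
  "(('m \<Rightarrow> 'm fn) \<Rightarrow> ('m \<Rightarrow> 'm fn) \<Rightarrow> 'm \<Rightarrow> 'm fn) \<Rightarrow> 'm bidiff \<Rightarrow> bool" where
  "has_coeffs B c \<longleftrightarrow>
     c \<in> bidiff_ops \<and> (\<forall>\<psi>\<in>tuples. \<forall>\<phi>\<in>tuples. B \<psi> \<phi> = bidiff_app c \<psi> \<phi>)"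

definition corresponding_fun ::
  "((('m::linorder) \<Rightarrow> 'm fn) \<Rightarrow> ('m \<Rightarrow> 'm fn) \<Rightarrow> 'm \<Rightarrow> 'm fn) \<Rightarrow> 'm \<Rightarrow> 'm gfun" where
  "corresponding_fun B = bidiff_fun (THE c. has_coeffs B c)"

end

theory Submission
  imports Defs
begin

text \<open>
  Fix \<open>\<psi>\<close> and \<open>\<phi>\<close>. Substituting \<open>D\<^sub>x\<^sup>i \<psi>\<^sup>a\<close> for \<open>p\<^sup>a\<^sub>i\<close> and \<open>D\<^sub>x\<^sup>j \<phi>\<^sup>b\<close> for \<open>q\<^sup>b\<^sub>j\<close> in functions that are
  linear in p, linear in q, or bilinear with all monomials written in the order pq is linear over the
  functions on the equation and intertwines the lifted total derivative with \<open>D\<^sub>x\<close>. It is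
  multiplicative on products of a p-linear by a q-linear function, and changes the sign of products
  in the opposite order. Hence it carries each term of the bracket to the corresponding term of
  \<open>C*(A,R)(\<psi>,\<phi>)\<close>; the two sign changes, in \<open>\<ell>\<^sub>N(H)\<close> and \<open>\<ell>*\<^sub>N(p)\<close>, account for the different signs in the
  two formulas. The coefficients of a bilinear operator are recovered at a point by inserting the
  Taylor monomials \<open>(x - x\<^sub>0)\<^sup>n / n!\<close>, so the corresponding function is unique.
\<close>

section \<open>Smooth functions\<close>

text \<open>\<open>smooth_fns\<close> is a condition on all iterated partial derivatives, hence the
  largest set stable under \<open>pd\<close> whose members satisfy the condition at order zero.
  Membership can thus be proved by exhibiting one stable set.\<close>

lemma smooth_fns_coinduct:
  assumes "a \<in> X"
    and fin: "\<And>a. a \<in> X \<Longrightarrow> \<exists>S. finite S \<and> (\<forall>z w. (\<forall>c\<in>S. z c = w c) \<longrightarrow> a z = a w)"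
    and cont: "\<And>a. a \<in> X \<Longrightarrow> continuous_on UNIV a"
    and diff: "\<And>a c z. a \<in> X \<Longrightarrow> (\<lambda>s. a (z(c := s))) differentiable (at (z c))"
    and pd: "\<And>a c. a \<in> X \<Longrightarrow> pd c a \<in> X"
  shows "a \<in> smooth_fns"
proof -
  have "foldr pd cs a \<in> X" for cs
    by (induction cs) (auto intro: pd assms(1))
  then show ?thesis
    using fin [OF assms(1)] cont diff unfolding smooth_fns_def by blast
qed

lemma smooth_fns_finite_dep:
  "a \<in> smooth_fns \<Longrightarrow> \<exists>S. finite S \<and> (\<forall>z w. (\<forall>c\<in>S. z c = w c) \<longrightarrow> a z = a w)"
  unfolding smooth_fns_def by blast

lemma smooth_fns_continuous: "a \<in> smooth_fns \<Longrightarrow> continuous_on UNIV a"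
  unfolding smooth_fns_def by (force dest: spec [of _ "[]"])

lemma smooth_fns_differentiable:
  "a \<in> smooth_fns \<Longrightarrow> (\<lambda>s. a (z(c := s))) differentiable (at (z c))"
  unfolding smooth_fns_def by (force dest: spec [of _ "[]"])

lemma pd_in_smooth_fns:
  assumes "a \<in> smooth_fns"
  shows "pd c a \<in> smooth_fns"
proof -
  obtain S where S: "finite S" "\<And>z w. (\<forall>c\<in>S. z c = w c) \<Longrightarrow> a z = a w"
    using smooth_fns_finite_dep [OF assms] by blast
  \<comment> \<open>\<open>c\<close> joins the set of coordinates because the derivative is
    evaluated at \<open>z c\<close>.\<close>
  have "pd c a z = pd c a w" if zw: "\<forall>d\<in>insert c S. z d = w d" for z w
  proof -
    have "a (z(c := s)) = a (w(c := s))" for s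
      using zw by (intro S(2)) auto
    then show ?thesis
      using zw by (simp add: pd_def)
  qed
  then have "\<exists>S. finite S \<and> (\<forall>z w. (\<forall>c\<in>S. z c = w c) \<longrightarrow> pd c a z = pd c a w)"
    using S(1) by (intro exI [of _ "insert c S"]) auto
  moreover have "foldr pd cs (pd c a) = foldr pd (cs @ [c]) a" for cs
    by simp
  ultimately show ?thesis
    using assms unfolding smooth_fns_def mem_Collect_eq by metis
qed

lemma has_derivative_pd:
  assumes "(\<lambda>s. a (z(c := s))) differentiable (at (z c))"
  shows "((\<lambda>s. a (z(c := s))) has_real_derivative pd c a z) (at (z c))"
  using assms by (simp add: pd_def DERIV_deriv_iff_real_differentiable)

lemma pd_eqI:
  assumes "\<And>z. ((\<lambda>s. a (z(c := s))) has_real_derivative b z) (at (z c))"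
  shows "pd c a = b"
  unfolding pd_def using DERIV_imp_deriv [OF assms] by auto

text \<open>
  Closure of \<^const>\<open>smooth_fns\<close> under sums and products by coinduction: the algebra generated by
  smooth functions is invariant under \<^const>\<open>pd\<close>.
\<close>

inductive_set smooth_alg :: "'m fn set" where
  base: "a \<in> smooth_fns \<Longrightarrow> a \<in> smooth_alg"
| const: "(\<lambda>_. r) \<in> smooth_alg"
| coord: "(\<lambda>z. z c) \<in> smooth_alg"
| add: "a \<in> smooth_alg \<Longrightarrow> b \<in> smooth_alg \<Longrightarrow> a + b \<in> smooth_alg"
| mult: "a \<in> smooth_alg \<Longrightarrow> b \<in> smooth_alg \<Longrightarrow> a * b \<in> smooth_alg"

lemma smooth_alg_differentiable:
  "a \<in> smooth_alg \<Longrightarrow> (\<lambda>s. a (z(c := s))) differentiable (at (z c))"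
proof (induction a rule: smooth_alg.induct)
  case (base a)
  then show ?case
    by (rule smooth_fns_differentiable)
next
  case (coord d)
  show ?case
    by (cases "d = c") auto
qed (simp_all add: plus_fun_def times_fun_def)

lemma pd_const [simp]: "pd c (\<lambda>_. r) = 0"
  by (rule pd_eqI) simp

lemma pd_coord: "pd c (\<lambda>z. z d) = (\<lambda>_. if c = d then 1 else 0)"
  by (rule pd_eqI) auto

text \<open>The sum and Leibniz rules are needed to prove that \<open>smooth_alg\<close> is stable
  under \<open>pd\<close>, so they are stated for this algebra first and carry over to
  \<open>smooth_fns\<close> once the two sets coincide.\<close>

lemma pd_add':
  assumes "a \<in> smooth_alg" "b \<in> smooth_alg"
  shows "pd c (a + b) = pd c a + pd c b"
proof (rule pd_eqI)
  fix z
  show "((\<lambda>s. (a + b) (z(c := s))) has_real_derivative (pd c a + pd c b) z) (at (z c))"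
    unfolding plus_fun_apply
    by (intro DERIV_add has_derivative_pd smooth_alg_differentiable assms)
qed

lemma pd_mult':
  assumes "a \<in> smooth_alg" "b \<in> smooth_alg"
  shows "pd c (a * b) = pd c a * b + a * pd c b"
proof (rule pd_eqI)
  fix z
  have "((\<lambda>s. a (z(c := s)) * b (z(c := s))) has_real_derivative
      pd c a z * b (z(c := z c)) + pd c b z * a (z(c := z c))) (at (z c))"
    by (intro DERIV_mult has_derivative_pd smooth_alg_differentiable assms)
  then show "((\<lambda>s. (a * b) (z(c := s))) has_real_derivative (pd c a * b + a * pd c b) z) (at (z c))"
    by (simp add: mult.commute)
qed

lemma smooth_alg_eq: "smooth_alg = (smooth_fns :: 'm fn set)"
proof
  show "smooth_alg \<subseteq> (smooth_fns :: 'm fn set)"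
  proof
    fix a :: "'m fn"
    assume "a \<in> smooth_alg"
    then show "a \<in> smooth_fns"
    proof (rule smooth_fns_coinduct)
      fix a :: "'m fn" and c :: "'m coord"
      assume "a \<in> smooth_alg"
      then show "\<exists>S. finite S \<and> (\<forall>z w. (\<forall>c\<in>S. z c = w c) \<longrightarrow> a z = a w)"
      proof (induction a rule: smooth_alg.induct)
        case (base a)
        then show ?case
          by (rule smooth_fns_finite_dep)
      next
        case (coord c)
        show ?case
          by (rule exI [of _ "{c}"]) auto
      next
        case (add a b)
        then obtain S T where "finite S" "\<forall>z w. (\<forall>c\<in>S. z c = w c) \<longrightarrow> a z = a w"
          "finite T" "\<forall>z w. (\<forall>c\<in>T. z c = w c) \<longrightarrow> b z = b w"
          by blast
        then show ?case
          by (intro exI [of _ "S \<union> T"]) (auto simp: plus_fun_def intro!: arg_cong2 [of _ _ _ _ "(+)"])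
      next
        case (mult a b)
        then obtain S T where "finite S" "\<forall>z w. (\<forall>c\<in>S. z c = w c) \<longrightarrow> a z = a w"
          "finite T" "\<forall>z w. (\<forall>c\<in>T. z c = w c) \<longrightarrow> b z = b w"
          by blast
        then show ?case
          by (intro exI [of _ "S \<union> T"]) (auto simp: times_fun_def intro!: arg_cong2 [of _ _ _ _ "(*)"])
      qed auto
    next
      fix a :: "'m fn"
      assume "a \<in> smooth_alg"
      then show "continuous_on UNIV a"
      proof (induction a rule: smooth_alg.induct)
        case (base a)
        then show ?case
          by (rule smooth_fns_continuous)
      next
        case (add a b)
        then show ?case
          unfolding plus_fun_def by (intro continuous_intros)
      next
        case (mult a b)
        then show ?case
          unfolding times_fun_def by (intro continuous_intros)
      qed (auto intro: continuous_on_product_coordinates)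
    next
      fix a :: "'m fn" and c :: "'m coord" and z
      assume "a \<in> smooth_alg"
      then show "(\<lambda>s. a (z(c := s))) differentiable (at (z c))"
        by (rule smooth_alg_differentiable)
    next
      fix a :: "'m fn" and c :: "'m coord"
      assume "a \<in> smooth_alg"
      then show "pd c a \<in> smooth_alg"
      proof (induction a rule: smooth_alg.induct)
        case (add a b)
        then show ?case
          by (subst pd_add') (auto intro: smooth_alg.add)
      next
        case (mult a b)
        then show ?case
          by (subst pd_mult') (auto intro: smooth_alg.add smooth_alg.mult)
      qed (auto simp: pd_coord zero_fun_def intro: smooth_alg.intros pd_in_smooth_fns)
    qed
  qed
qed (auto intro: smooth_alg.base)

lemmas const_in_smooth_fns = smooth_alg.const [unfolded smooth_alg_eq]
  and coord_in_smooth_fns = smooth_alg.coord [unfolded smooth_alg_eq]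
  and add_in_smooth_fns = smooth_alg.add [unfolded smooth_alg_eq]
  and mult_in_smooth_fns = smooth_alg.mult [unfolded smooth_alg_eq]
  and pd_add = pd_add' [unfolded smooth_alg_eq]
  and pd_mult = pd_mult' [unfolded smooth_alg_eq]

lemma zero_in_smooth_fns: "0 \<in> smooth_fns"
  unfolding zero_fun_def by (rule const_in_smooth_fns)

lemma one_in_smooth_fns: "1 \<in> smooth_fns"
  unfolding one_fun_def by (rule const_in_smooth_fns)

lemma minus_one_in_smooth_fns: "- 1 \<in> smooth_fns"
  unfolding one_fun_def fun_Compl_def by (rule const_in_smooth_fns)

lemma power_in_smooth_fns: "a \<in> smooth_fns \<Longrightarrow> a ^ n \<in> smooth_fns"
  by (induction n) (auto intro: one_in_smooth_fns mult_in_smooth_fns)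

lemma sum_in_smooth_fns: "(\<And>x. x \<in> J \<Longrightarrow> a x \<in> smooth_fns) \<Longrightarrow> sum a J \<in> smooth_fns"
  by (induction J rule: infinite_finite_induct) (auto intro: zero_in_smooth_fns add_in_smooth_fns)

lemma u_fn_in_smooth_fns: "u_fn j k \<in> smooth_fns"
  unfolding u_fn_def by (rule coord_in_smooth_fns)

lemmas smooth_intros =
  const_in_smooth_fns zero_in_smooth_fns one_in_smooth_fns minus_one_in_smooth_fns
  add_in_smooth_fns mult_in_smooth_fns power_in_smooth_fns sum_in_smooth_fns
  u_fn_in_smooth_fns pd_in_smooth_fns

lemma pd_one [simp]: "pd c 1 = 0"
  unfolding one_fun_def by simp

section \<open>Total derivative of smooth functions\<close>

lemma finite_u_support:
  assumes "a \<in> smooth_fns"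
  shows "finite {(j, k). pd (Uc j k) a \<noteq> 0}"
proof -
  have "inj (\<lambda>(j, k). Uc j k :: 'a coord)"
    by (auto simp: inj_def)
  from finite_vimageI [OF finite_pd_support [OF assms] this] show ?thesis
    by (simp add: vimage_def case_prod_unfold)
qed

text \<open>The index set is left free so that several functions can be expanded over one common
  set, such as the union of their supports, after which \<open>Dx\<close> is handled as a finite
  sum.\<close>

lemma Dx_eq_sum:
  assumes "finite J" "\<And>j k. (j, k) \<notin> J \<Longrightarrow> pd (Uc j k) a = 0"
  shows "Dx a = pd Xc a + (\<Sum>(j, k)\<in>J. u_fn j (Suc k) * pd (Uc j k) a)"
proof -
  have "{(j, k). u_fn j (Suc k) * pd (Uc j k) a \<noteq> 0} \<subseteq> J"
    using assms(2) by (metis (mono_tags, lifting) mem_Collect_eq mult_zero_right prod.case subrelI)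
  then show ?thesis
    unfolding Dx_def using Sum_any.expand_superset [OF assms(1)] by (simp add: case_prod_unfold)
qed

lemma Dx_zero [simp]: "Dx 0 = 0"
  by (subst Dx_eq_sum [of "{}"]) auto

lemma Dx_one [simp]: "Dx 1 = 0"
  by (subst Dx_eq_sum [of "{}"]) auto

lemma Dx_in_smooth_fns:
  assumes "a \<in> smooth_fns"
  shows "Dx a \<in> smooth_fns"
  by (subst Dx_eq_sum [OF finite_u_support [OF assms]])
    (auto intro!: smooth_intros assms)

lemma Dx_add:
  assumes "a \<in> smooth_fns" "b \<in> smooth_fns"
  shows "Dx (a + b) = Dx a + Dx b"
proof -
  let ?J = "{(j, k). pd (Uc j k) a \<noteq> 0} \<union> {(j, k). pd (Uc j k) b \<noteq> 0}"
  have J: "finite ?J"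
    using assms by (simp add: finite_u_support)
  show ?thesis
    by (subst (1 2 3) Dx_eq_sum [OF J])
      (auto simp: pd_add assms distrib_left sum.distrib case_prod_beta)
qed

lemma Dx_mult:
  assumes "a \<in> smooth_fns" "b \<in> smooth_fns"
  shows "Dx (a * b) = Dx a * b + a * Dx b"
proof -
  let ?J = "{(j, k). pd (Uc j k) a \<noteq> 0} \<union> {(j, k). pd (Uc j k) b \<noteq> 0}"
  have J: "finite ?J"
    using assms by (simp add: finite_u_support)
  show ?thesis
    by (subst (1 2 3) Dx_eq_sum [OF J])
      (auto simp: pd_mult assms algebra_simps sum.distrib case_prod_beta sum_distrib_left)
qed

lemma Dx_sum:
  "(\<And>x. x \<in> J \<Longrightarrow> a x \<in> smooth_fns) \<Longrightarrow> Dx (sum a J) = (\<Sum>x\<in>J. Dx (a x))"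
  by (induction J rule: infinite_finite_induct) (auto simp: Dx_add sum_in_smooth_fns)

lemma Dx_funpow_in_smooth_fns: "a \<in> smooth_fns \<Longrightarrow> (Dx ^^ k) a \<in> smooth_fns"
  by (induction k) (auto intro: Dx_in_smooth_fns)

section \<open>The Grassmann algebra\<close>

text \<open>Scalar action of functions. It agrees with \<open>gconst a \<bullet>\<^sub>g F\<close>
  when \<open>F\<close> vanishes at infinite sets and, being pointwise, involves neither sums over
  subsets nor signs.\<close>

definition smul :: "'m fn \<Rightarrow> 'm gfun \<Rightarrow> 'm gfun" where
  "smul a F = (\<lambda>S. a * F S)"

lemma smul_zero [simp]: "smul 0 F = 0" "smul a 0 = 0"
  by (simp_all add: smul_def fun_eq_iff)

lemma smul_one [simp]: "smul 1 F = F"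
  by (simp add: smul_def fun_eq_iff)

lemma smul_smul: "smul a (smul b F) = smul (a * b) F"
  by (simp add: smul_def fun_eq_iff)

lemma smul_add_right: "smul a (F + G) = smul a F + smul a G"
  by (simp add: smul_def fun_eq_iff algebra_simps)

lemma smul_minus_one: "smul (- 1) F = - F"
  by (simp add: smul_def fun_eq_iff)

text \<open>The sign in \<open>tlin_adj\<close> is a power in the pointwise ring of
  \<open>gfun\<close>; here it becomes a smooth scalar, to which linearity applies.\<close>

lemma smul_power_minus_one: "smul ((- 1) ^ k) F = (- 1) ^ k * F"
  by (induction k) (simp_all add: smul_def fun_eq_iff)

lemma gmul_add_left: "(F + G) \<bullet>\<^sub>g H = F \<bullet>\<^sub>g H + G \<bullet>\<^sub>g H"
  by (simp add: gmul_def fun_eq_iff algebra_simps sum.distrib)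

lemma gmul_add_right: "F \<bullet>\<^sub>g (G + H) = F \<bullet>\<^sub>g G + F \<bullet>\<^sub>g H"
  by (simp add: gmul_def fun_eq_iff algebra_simps sum.distrib)

lemma gmul_zero [simp]: "0 \<bullet>\<^sub>g F = 0" "F \<bullet>\<^sub>g 0 = 0"
  by (simp_all add: gmul_def fun_eq_iff)

lemma gmul_smul_left: "smul a F \<bullet>\<^sub>g G = smul a (F \<bullet>\<^sub>g G)"
  unfolding gmul_def smul_def sum_distrib_left by (simp add: algebra_simps)

lemma gmul_smul_right: "F \<bullet>\<^sub>g smul a G = smul a (F \<bullet>\<^sub>g G)"
  unfolding gmul_def smul_def sum_distrib_left by (simp add: algebra_simps)

text \<open>The product \<^const>\<open>gmul\<close> vanishes at infinite sets, as the sum over an infinite power set is 0.\<close>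

lemma gconst_gmul:
  assumes "\<And>S. infinite S \<Longrightarrow> F S = 0"
  shows "gconst a \<bullet>\<^sub>g F = smul a F"
proof
  fix S
  show "(gconst a \<bullet>\<^sub>g F) S = smul a F S"
  proof (cases "finite S")
    case True
    then have "(gconst a \<bullet>\<^sub>g F) S = (\<Sum>T\<in>{{}}.
        (-1) ^ card {(g, h). g \<in> T \<and> h \<in> S - T \<and> h < g} * (gconst a T * F (S - T)))"
      unfolding gmul_def by (intro sum.mono_neutral_right) (auto simp: gconst_def)
    then show ?thesis
      by (simp add: gconst_def smul_def)
  next
    case False
    then show ?thesis
      by (simp add: gmul_def smul_def assms)
  qed
qed

lemma gen_infinite: "infinite S \<Longrightarrow> gen g S = 0"
  by (auto simp: gen_def)

text \<open>In the order on \<open>odd_var\<close> every p precedes every q, so a product pq is a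
  basis monomial with sign \<open>+1\<close>.\<close>

lemma pvar_gmul_qvar: "pvar a i \<bullet>\<^sub>g qvar b j = (\<lambda>S. if S = {Pvar a i, Qvar b j} then 1 else 0)"
  by (auto simp: gen_gmul_gen)

section \<open>Derivatives in the odd variables\<close>

lemma odd_pd_zero [simp]: "odd_pd g 0 = 0"
  by (simp add: odd_pd_def fun_eq_iff)

lemma odd_pd_add: "odd_pd g (F + G) = odd_pd g F + odd_pd g G"
  by (auto simp add: odd_pd_def distrib_left)

lemma odd_pd_smul: "odd_pd g (smul a F) = smul a (odd_pd g F)"
  by (auto simp add: odd_pd_def smul_def mult.left_commute)

lemma odd_pd_gen: "odd_pd g (gen h) = (if g = h then gconst 1 else 0)"
proof (rule ext)
  fix S
  have *: "insert g S = {h} \<and> g \<notin> S \<longleftrightarrow> g = h \<and> S = {}"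
    by blast
  show "odd_pd g (gen h) S = (if g = h then gconst 1 else 0) S"
  proof (cases "g = h \<and> S = {}")
    case True
    then show ?thesis
      by (simp add: odd_pd_def gen_def gconst_def)
  next
    case False
    with * have "g \<notin> S \<Longrightarrow> insert g S \<noteq> {h}"
      by blast
    then have "odd_pd g (gen h) S = 0"
      by (cases "g \<in> S") (simp_all only: odd_pd_def gen_def if_True if_False mult_zero_right not_False_eq_True)
    with False show ?thesis
      by (simp add: gconst_def)
  qed
qed

lemma insert_doubleton_iff:
  assumes "P \<noteq> Q"
  shows "insert g S = {P, Q} \<and> g \<notin> S \<longleftrightarrow> g = P \<and> S = {Q} \<or> g = Q \<and> S = {P}"
proof -
  have "insert g S = {P, Q} \<and> g \<notin> S \<longleftrightarrow> g \<in> {P, Q} \<and> S = {P, Q} - {g}"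
    by auto
  then show ?thesis
    using assms by auto
qed

text \<open>A left derivative in q must first pass the p in front of it; in the sign of
  \<open>odd_pd\<close> this is the single p below q.\<close>

lemma odd_pd_pvar_gmul_qvar:
  "odd_pd g (pvar a i \<bullet>\<^sub>g qvar b j) =
     (if g = Pvar a i then qvar b j else if g = Qvar b j then - pvar a i else 0)"
proof (rule ext)
  fix S
  let ?P = "Pvar a i" and ?Q = "Qvar b j"
  have *: "insert g S = {?P, ?Q} \<and> g \<notin> S \<longleftrightarrow> g = ?P \<and> S = {?Q} \<or> g = ?Q \<and> S = {?P}"
    by (intro insert_doubleton_iff) simp
  have empty: "{h. h = ?Q \<and> h < ?P} = {}" and single: "{h. h = ?P \<and> h < ?Q} = {?P}"
    by auto
  consider "g = ?P" "S = {?Q}" | "g = ?Q" "S = {?P}"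
    | "\<not> (g = ?P \<and> S = {?Q})" "\<not> (g = ?Q \<and> S = {?P})"
    by blast
  then show "odd_pd g (pvar a i \<bullet>\<^sub>g qvar b j) S =
      (if g = ?P then qvar b j else if g = ?Q then - pvar a i else 0) S"
  proof cases
    case 1
    then show ?thesis
      unfolding pvar_gmul_qvar by (simp add: odd_pd_def gen_def empty)
  next
    case 2
    then show ?thesis
      unfolding pvar_gmul_qvar by (simp add: odd_pd_def gen_def single insert_commute)
  next
    case 3
    with * have "g \<notin> S \<Longrightarrow> insert g S \<noteq> {?P, ?Q}"
      by blast
    then have "odd_pd g (pvar a i \<bullet>\<^sub>g qvar b j) S = 0"
      by (cases "g \<in> S")
        (simp_all only: odd_pd_def pvar_gmul_qvar if_True if_False mult_zero_right not_False_eq_True)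
    with 3 show ?thesis
      by (simp add: gen_def)
  qed
qed

text \<open>The type \<open>gfun\<close> is larger than the Grassmann algebra. These elements have
  finitely many monomials, each of finite degree, with smooth coefficients; for them the sum in
  \<open>tDx\<close> is finite and \<open>gconst\<close> acts as a scalar.\<close>

definition fin_gfuns :: "'m gfun set" where
  "fin_gfuns = {F. finite {S. F S \<noteq> 0} \<and> (\<forall>S. infinite S \<longrightarrow> F S = 0) \<and> (\<forall>S. F S \<in> smooth_fns)}"

lemma zero_in_fin_gfuns: "0 \<in> fin_gfuns"
  by (simp add: fin_gfuns_def zero_in_smooth_fns)

lemma gen_in_fin_gfuns: "gen g \<in> fin_gfuns"
  by (auto simp: fin_gfuns_def gen_def zero_in_smooth_fns one_in_smooth_fns)

lemma pvar_gmul_qvar_in_fin_gfuns: "pvar a i \<bullet>\<^sub>g qvar b j \<in> fin_gfuns"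
  unfolding pvar_gmul_qvar by (auto simp: fin_gfuns_def zero_in_smooth_fns one_in_smooth_fns)

lemma add_in_fin_gfuns:
  assumes "F \<in> fin_gfuns" "G \<in> fin_gfuns"
  shows "F + G \<in> fin_gfuns"
proof -
  have "finite ({S. F S \<noteq> 0} \<union> {S. G S \<noteq> 0})"
    using assms by (simp add: fin_gfuns_def)
  then have "finite {S. (F + G) S \<noteq> 0}"
    by (rule rev_finite_subset) auto
  then show ?thesis
    using assms by (auto simp: fin_gfuns_def add_in_smooth_fns)
qed

lemma smul_in_fin_gfuns:
  assumes "a \<in> smooth_fns" "F \<in> fin_gfuns"
  shows "smul a F \<in> fin_gfuns"
proof -
  have "finite {S. smul a F S \<noteq> 0}"
    using assms(2) by (auto simp: fin_gfuns_def smul_def intro: rev_finite_subset)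
  then show ?thesis
    using assms by (auto simp: fin_gfuns_def smul_def mult_in_smooth_fns)
qed

lemma finite_odd_support:
  assumes "F \<in> fin_gfuns"
  shows "finite {g. odd_pd g F \<noteq> 0}"
proof -
  \<comment> \<open>A variable with nonzero derivative occurs in one of the finitely many finite
    monomials of \<open>F\<close>.\<close>
  have "g \<in> \<Union>{S. F S \<noteq> 0}" if "odd_pd g F \<noteq> 0" for g
  proof -
    obtain S where "odd_pd g F S \<noteq> 0"
      using \<open>odd_pd g F \<noteq> 0\<close> by (metis ext zero_fun_apply)
    then have "F (insert g S) \<noteq> 0"
      by (auto simp: odd_pd_def split: if_splits)
    then show ?thesis
      by blast
  qed
  moreover have "finite (\<Union>{S. F S \<noteq> 0})"
    using assms by (auto simp: fin_gfuns_def)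
  ultimately show ?thesis
    by (blast intro: finite_subset)
qed

section \<open>The lifted total derivative\<close>

definition odd_tDx :: "('m::linorder) gfun \<Rightarrow> 'm \<times> nat \<Rightarrow> 'm gfun" where
  "odd_tDx F = (\<lambda>(j, k). qvar j (Suc k) \<bullet>\<^sub>g odd_pd (Qvar j k) F
                       + pvar j (Suc k) \<bullet>\<^sub>g odd_pd (Pvar j k) F)"

lemma finite_odd_tDx:
  assumes "F \<in> fin_gfuns"
  shows "finite {x. odd_tDx F x \<noteq> 0}"
proof -
  let ?V = "{g. odd_pd g F \<noteq> 0}"
  have "inj (\<lambda>(j, k). Qvar j k :: 'a odd_var)" "inj (\<lambda>(j, k). Pvar j k :: 'a odd_var)"
    by (auto simp: inj_def)
  then have "finite ((\<lambda>(j, k). Qvar j k) -` ?V \<union> (\<lambda>(j, k). Pvar j k) -` ?V)"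
    using finite_vimageI [OF finite_odd_support [OF assms]] by blast
  then show ?thesis
    by (rule rev_finite_subset) (auto simp: odd_tDx_def)
qed

lemma odd_tDx_add: "odd_tDx (F + G) x = odd_tDx F x + odd_tDx G x"
  by (simp add: odd_tDx_def case_prod_unfold odd_pd_add gmul_add_right)

lemma odd_tDx_smul: "odd_tDx (smul a F) x = smul a (odd_tDx F x)"
  by (simp add: odd_tDx_def case_prod_unfold odd_pd_smul gmul_smul_right smul_add_right)

lemma tDx_alt: "tDx F = (\<lambda>S. Dx (F S)) + Sum_any (odd_tDx F)"
  by (simp add: tDx_def odd_tDx_def)

lemma smul_sum: "smul a (sum F J) = (\<Sum>x\<in>J. smul a (F x))"
  using sum_comp_morphism [of "smul a" F J] by (simp add: smul_add_right comp_def)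

lemma tDx_add:
  assumes "F \<in> fin_gfuns" "G \<in> fin_gfuns"
  shows "tDx (F + G) = tDx F + tDx G"
proof -
  have "(\<lambda>S. Dx ((F + G) S)) = (\<lambda>S. Dx (F S)) + (\<lambda>S. Dx (G S))"
    using assms by (simp add: fin_gfuns_def fun_eq_iff Dx_add)
  moreover have "Sum_any (odd_tDx (F + G)) = Sum_any (odd_tDx F) + Sum_any (odd_tDx G)"
    unfolding odd_tDx_add by (intro Sum_any.distrib finite_odd_tDx assms)
  ultimately show ?thesis
    by (simp add: tDx_alt)
qed

lemma tDx_smul:
  assumes "a \<in> smooth_fns" "F \<in> fin_gfuns"
  shows "tDx (smul a F) = smul (Dx a) F + smul a (tDx F)"
proof -
  let ?J = "{x. odd_tDx F x \<noteq> 0}"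
  have J: "finite ?J"
    using assms(2) by (rule finite_odd_tDx)
  have "Sum_any (odd_tDx (smul a F)) = (\<Sum>x\<in>?J. odd_tDx (smul a F) x)"
    using J by (intro Sum_any.expand_superset) (auto simp: odd_tDx_smul)
  also have "\<dots> = smul a (Sum_any (odd_tDx F))"
    by (simp add: odd_tDx_smul smul_sum Sum_any.expand_set)
  finally have "Sum_any (odd_tDx (smul a F)) = smul a (Sum_any (odd_tDx F))" .
  moreover have "(\<lambda>S. Dx (smul a F S)) = smul (Dx a) F + smul a (\<lambda>S. Dx (F S))"
    using assms by (simp add: fin_gfuns_def smul_def fun_eq_iff Dx_mult)
  ultimately show ?thesis
    by (simp add: tDx_alt smul_add_right)
qed

text \<open>\<open>gconst_gmul\<close> treats a scalar on the left; in \<open>tDx\<close> the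
  derivative of a generator leaves the unit on the right.\<close>

lemma gen_gmul_gconst_one: "gen g \<bullet>\<^sub>g gconst 1 = gen g"
proof
  fix S
  let ?t = "\<lambda>T. (-1) ^ card {(x, y). x \<in> T \<and> y \<in> S - T \<and> y < x} * (gen g T * gconst 1 (S - T))"
  show "(gen g \<bullet>\<^sub>g gconst 1) S = gen g S"
  proof (cases "S = {g}")
    case True
    then have "(gen g \<bullet>\<^sub>g gconst 1) S = (\<Sum>T\<in>{{g}}. ?t T)"
      unfolding gmul_def by (intro sum.mono_neutral_right) (auto simp: gen_def)
    with True show ?thesis
      by (simp add: gen_def gconst_def)
  next
    case False
    then have "?t T = 0" if "T \<in> Pow S" for T
      using that by (cases "T = {g}") (auto simp: gen_def gconst_def)
    then have "(gen g \<bullet>\<^sub>g gconst 1) S = 0"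
      unfolding gmul_def by (rule sum.neutral [OF ballI])
    with False show ?thesis
      by (simp add: gen_def)
  qed
qed

lemma Dx_gen: "Dx (gen g S) = 0"
  by (simp add: gen_def)

lemma tDx_pvar: "tDx (pvar j k) = pvar j (Suc k)"
proof -
  have "Sum_any (odd_tDx (pvar j k)) = (\<Sum>x\<in>{(j, k)}. odd_tDx (pvar j k) x)"
    by (intro Sum_any.expand_superset) (auto simp: odd_tDx_def odd_pd_gen split: if_splits)
  then show ?thesis
    by (simp add: tDx_alt Dx_gen odd_tDx_def odd_pd_gen gen_gmul_gconst_one fun_eq_iff)
qed

lemma tDx_qvar: "tDx (qvar j k) = qvar j (Suc k)"
proof -
  have "Sum_any (odd_tDx (qvar j k)) = (\<Sum>x\<in>{(j, k)}. odd_tDx (qvar j k) x)"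
    by (intro Sum_any.expand_superset) (auto simp: odd_tDx_def odd_pd_gen split: if_splits)
  then show ?thesis
    by (simp add: tDx_alt Dx_gen odd_tDx_def odd_pd_gen gen_gmul_gconst_one fun_eq_iff)
qed

lemma gmul_minus_right: "F \<bullet>\<^sub>g (- G) = - (F \<bullet>\<^sub>g G)"
  by (simp add: gmul_smul_right flip: smul_minus_one)

text \<open>The minus sign of the derivative in q cancels against the one from moving the new q
  behind p, so this Leibniz rule is free of signs, like that of \<open>Dx\<close> on products of
  functions.\<close>

lemma tDx_pvar_gmul_qvar:
  "tDx (pvar a i \<bullet>\<^sub>g qvar b j) = pvar a (Suc i) \<bullet>\<^sub>g qvar b j + pvar a i \<bullet>\<^sub>g qvar b (Suc j)"
proof -
  let ?F = "pvar a i \<bullet>\<^sub>g qvar b j"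
  \<comment> \<open>One index of the sum carries both a p-part and a q-part. Two indicator terms
    keep them apart, as they fall on the same index when \<open>(a, i) = (b, j)\<close>.\<close>
  let ?P = "\<lambda>x. if x = (a, i) then pvar a (Suc i) \<bullet>\<^sub>g qvar b j else 0"
  let ?Q = "\<lambda>x. if x = (b, j) then pvar a i \<bullet>\<^sub>g qvar b (Suc j) else 0"
  have "odd_tDx ?F x = ?P x + ?Q x" for x
    by (cases x) (auto simp: odd_tDx_def odd_pd_pvar_gmul_qvar gmul_minus_right
        gen_anticommute [of "Qvar b (Suc j)" "Pvar a i"])
  then have "Sum_any (odd_tDx ?F) = (\<Sum>x\<in>{(a, i), (b, j)}. ?P x + ?Q x)"
    by (subst Sum_any.expand_superset [of "{(a, i), (b, j)}"]) (auto split: if_splits)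
  also have "\<dots> = pvar a (Suc i) \<bullet>\<^sub>g qvar b j + pvar a i \<bullet>\<^sub>g qvar b (Suc j)"
    by (cases "(a, i) = (b, j)") auto
  moreover have "(\<lambda>S. Dx (?F S)) = 0"
    by (simp add: pvar_gmul_qvar fun_eq_iff)
  ultimately show ?thesis
    by (simp add: tDx_alt)
qed

lemma tDx_funpow_pvar: "(tDx ^^ i) (pvar j k) = pvar j (i + k)"
  by (induction i) (simp_all add: tDx_pvar)

section \<open>Coefficients of operators\<close>

lemma Dx_minus:
  assumes "a \<in> smooth_fns"
  shows "Dx (- a) = - Dx a"
proof -
  have "- a \<in> smooth_fns"
    using mult_in_smooth_fns [OF minus_one_in_smooth_fns assms] by simp
  then have "Dx a + Dx (- a) = 0"
    using Dx_add [OF assms] by force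
  then show ?thesis
    by (simp add: eq_neg_iff_add_eq_0 add.commute)
qed

lemma minus_in_smooth_fns: "a \<in> smooth_fns \<Longrightarrow> - a \<in> smooth_fns"
  using mult_in_smooth_fns [OF minus_one_in_smooth_fns, of a] by simp

lemma Dx_funpow_minus: "a \<in> smooth_fns \<Longrightarrow> (Dx ^^ k) (- a) = - (Dx ^^ k) a"
  by (induction k) (simp_all only: funpow.simps comp_apply id_apply Dx_minus Dx_funpow_in_smooth_fns)

text \<open>One bound serves all entries: with finitely many components, every operator becomes a
  sum over \<open>UNIV \<times> {..N}\<close>.\<close>

definition order_le :: "nat \<Rightarrow> 'm cdiff \<Rightarrow> bool" where
  "order_le N M \<longleftrightarrow> (\<forall>l j i. N < i \<longrightarrow> M l j i = 0)"

lemma order_leD: "order_le N M \<Longrightarrow> N < i \<Longrightarrow> M l j i = 0"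
  by (simp add: order_le_def)

lemma cdiff_ops_order_le:
  fixes M :: "('m::finite) cdiff"
  assumes "M \<in> cdiff_ops"
  obtains N where "order_le N M"
proof -
  have "finite (\<Union>l. \<Union>j. {i. M l j i \<noteq> 0})"
    using assms by (simp add: cdiff_ops_def)
  then obtain N where N: "\<forall>i\<in>(\<Union>l. \<Union>j. {i. M l j i \<noteq> 0}). i \<le> N"
    unfolding finite_nat_set_iff_bounded_le by (rule exE)
  show thesis
  proof (rule that, unfold order_le_def, intro allI impI)
    fix l j i
    assume "N < i"
    then have "i \<notin> (\<Union>l. \<Union>j. {i. M l j i \<noteq> 0})"
      using N linorder_not_le by (metis (no_types, lifting))
    then show "M l j i = 0"
      by simp
  qed
qed

text \<open>The jet order of the coefficients of \<open>M\<close> bounds the order of its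
  linearization \<open>lin_mat M \<psi>\<close>, for all \<open>\<psi>\<close> at once.\<close>

lemma pd_coeff_bound:
  fixes M :: "('m::finite) cdiff"
  assumes "M \<in> cdiff_ops"
  obtains N where "\<And>l b i j k. N < k \<Longrightarrow> pd (Uc j k) (M l b i) = 0"
proof -
  obtain N where N: "order_le N M"
    using cdiff_ops_order_le [OF assms] .
  \<comment> \<open>Beyond the order of \<open>M\<close> the coefficients vanish, which leaves a
    finite union.\<close>
  let ?K = "\<Union>l. \<Union>b. \<Union>i\<in>{..N}. snd ` {(j, k). pd (Uc j k) (M l b i) \<noteq> 0}"
  have "finite ?K"
    using assms by (auto simp: cdiff_ops_def intro!: finite_u_support)
  then obtain K where K: "\<forall>k\<in>?K. k \<le> K"
    unfolding finite_nat_set_iff_bounded_le by (rule exE)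
  show thesis
  proof (rule that)
    fix l b i j k
    assume "K < k"
    show "pd (Uc j k) (M l b i) = 0"
    proof (cases "i \<le> N")
      case True
      show ?thesis
      proof (rule ccontr)
        assume "pd (Uc j k) (M l b i) \<noteq> 0"
        then have "k \<in> snd ` {(j, k). pd (Uc j k) (M l b i) \<noteq> 0}"
          by force
        with True have "k \<in> ?K"
          by blast
        with K \<open>K < k\<close> show False
          by (meson not_le)
      qed
    qed (simp add: order_leD [OF N])
  qed
qed

lemma Sum_any_eq_sum_Times:
  fixes g :: "('m::finite) \<Rightarrow> nat \<Rightarrow> 'a::comm_monoid_add"
  assumes "\<And>j i. N < i \<Longrightarrow> g j i = 0"
  shows "Sum_any (\<lambda>(j, i). g j i) = (\<Sum>(j, i)\<in>UNIV \<times> {..N}. g j i)"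
proof (rule Sum_any.expand_superset)
  show "{x. (case x of (j, i) \<Rightarrow> g j i) \<noteq> 0} \<subseteq> UNIV \<times> {..N}"
    using assms by (auto intro!: leI)
qed simp

lemma app_eq_sum:
  fixes M :: "('m::finite) cdiff"
  assumes "order_le N M"
  shows "app M \<phi> l = (\<Sum>(j, i)\<in>UNIV \<times> {..N}. M l j i * (Dx ^^ i) (\<phi> j))"
  unfolding app_def by (rule Sum_any_eq_sum_Times) (simp add: order_leD [OF assms])

lemma lin_mat_eq_sum:
  fixes M :: "('m::finite) cdiff"
  assumes "order_le N M"
  shows "lin_mat M \<psi> l j k =
    (\<Sum>(b, i)\<in>UNIV \<times> {..N}. pd (Uc j k) (M l b i) * (Dx ^^ i) (\<psi> b))"
  unfolding lin_mat_def by (rule Sum_any_eq_sum_Times) (simp add: order_leD [OF assms])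

lemma lin_mat_in_cdiff_ops:
  fixes M :: "('m::finite) cdiff"
  assumes "M \<in> cdiff_ops" "\<psi> \<in> tuples"
  shows "lin_mat M \<psi> \<in> cdiff_ops"
proof -
  obtain N where N: "order_le N M"
    using cdiff_ops_order_le [OF assms(1)] .
  obtain K where K: "\<And>l b i j k. K < k \<Longrightarrow> pd (Uc j k) (M l b i) = 0"
    using pd_coeff_bound [OF assms(1)] by metis
  have zero: "lin_mat M \<psi> l j k = 0" if "K < k" for l j k
    unfolding lin_mat_def using that by (simp add: K)
  have "finite {k. lin_mat M \<psi> l j k \<noteq> 0}" for l j
    by (rule finite_subset [of _ "{..K}"]) (auto intro!: leI simp: zero)
  moreover have "lin_mat M \<psi> l j k \<in> smooth_fns" for l j k
    unfolding lin_mat_eq_sum [OF N] using assms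
    by (auto simp: cdiff_ops_def tuples_def intro!: smooth_intros Dx_funpow_in_smooth_fns)
  ultimately show ?thesis
    by (simp add: cdiff_ops_def)
qed

text \<open>\<open>c i\<close> lists the coefficients of the composition of \<open>Dx ^^ i\<close>
  with multiplication by \<open>a\<close>. Smoothness and the order bound are part of the induction
  because the Leibniz rule needs the first and the truncation of the sum the second.\<close>

lemma Dx_comp_funpow:
  assumes "a \<in> smooth_fns" "g \<in> smooth_fns"
  defines "c i \<equiv> (Dx_comp ^^ i) (\<lambda>r. if r = 0 then a else 0)"
  shows "(\<forall>n. c i n \<in> smooth_fns) \<and> (\<forall>n>i. c i n = 0) \<and>
    (\<Sum>n\<le>i. c i n * (Dx ^^ n) g) = (Dx ^^ i) (a * g)"
proof (induction i)
  case 0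
  show ?case
    using assms by (simp add: c_def zero_in_smooth_fns)
next
  case (Suc i)
  have step: "c (Suc i) n = Dx (c i n) + (case n of 0 \<Rightarrow> 0 | Suc k \<Rightarrow> c i k)" for n
    unfolding c_def by (simp add: Dx_comp_def)
  have smooth: "c i n \<in> smooth_fns" and zero: "i < n \<Longrightarrow> c i n = 0" for n
    using Suc by auto
  have "c (Suc i) n \<in> smooth_fns" for n
    unfolding step by (auto split: nat.split intro!: add_in_smooth_fns Dx_in_smooth_fns smooth zero_in_smooth_fns)
  moreover have "c (Suc i) n = 0" if "Suc i < n" for n
    using that unfolding step by (cases n) (simp_all add: zero)
  moreover have "(\<Sum>n\<le>Suc i. c (Suc i) n * (Dx ^^ n) g) = (Dx ^^ Suc i) (a * g)"
  proof -
    \<comment> \<open>The two summands of \<open>Dx_comp\<close> give the two halves of the Leibniz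
      rule. The first loses its top term since \<open>c i\<close> has order at most
      \<open>i\<close>; in the second the term at 0 vanishes and the index shifts by one.\<close>
    have "(\<Sum>n\<le>Suc i. c (Suc i) n * (Dx ^^ n) g) =
        (\<Sum>n\<le>Suc i. Dx (c i n) * (Dx ^^ n) g) +
        (\<Sum>n\<le>Suc i. (case n of 0 \<Rightarrow> 0 | Suc k \<Rightarrow> c i k) * (Dx ^^ n) g)"
      unfolding step distrib_right by (rule sum.distrib)
    also have "(\<Sum>n\<le>Suc i. Dx (c i n) * (Dx ^^ n) g) = (\<Sum>n\<le>i. Dx (c i n) * (Dx ^^ n) g)"
      by (simp add: zero)
    also have "(\<Sum>n\<le>Suc i. (case n of 0 \<Rightarrow> 0 | Suc k \<Rightarrow> c i k) * (Dx ^^ n) g) =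
        (\<Sum>n\<le>i. c i n * Dx ((Dx ^^ n) g))"
      by (simp add: sum.atMost_Suc_shift del: sum.atMost_Suc)
    also have "(\<Sum>n\<le>i. Dx (c i n) * (Dx ^^ n) g) + (\<Sum>n\<le>i. c i n * Dx ((Dx ^^ n) g)) =
        (\<Sum>n\<le>i. Dx (c i n * (Dx ^^ n) g))"
      by (simp add: sum.distrib Dx_mult smooth Dx_funpow_in_smooth_fns assms(2))
    also have "\<dots> = Dx (\<Sum>n\<le>i. c i n * (Dx ^^ n) g)"
      by (simp add: Dx_sum mult_in_smooth_fns smooth Dx_funpow_in_smooth_fns assms(2))
    also have "(\<Sum>n\<le>i. c i n * (Dx ^^ n) g) = (Dx ^^ i) (a * g)"
      using Suc by blast
    finally have "(\<Sum>n\<le>Suc i. c (Suc i) n * (Dx ^^ n) g) = Dx ((Dx ^^ i) (a * g))" .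
    then show ?thesis
      by (simp del: sum.atMost_Suc)
  qed
  ultimately show ?case
    by blast
qed

lemma adj_eq_sum:
  assumes "order_le N M"
  shows "adj M j l n =
    (\<Sum>i\<le>N. (-1) ^ i * (Dx_comp ^^ i) (\<lambda>r. if r = 0 then M l j i else 0) n)"
  unfolding adj_def
proof (rule Sum_any.expand_superset)
  have "(Dx_comp ^^ i) (\<lambda>r. if r = 0 then M l j i else 0) n = 0" if "N < i" for i
  proof -
    \<comment> \<open>Beyond the order of \<open>M\<close> the recursion starts from the zero
      sequence, which \<open>Dx_comp\<close> preserves.\<close>
    have "Dx_comp 0 = (0 :: nat \<Rightarrow> 'a fn)"
      by (rule ext) (simp add: Dx_comp_def split: nat.split)
    then have "(Dx_comp ^^ k) 0 = (0 :: nat \<Rightarrow> 'a fn)" for k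
      by (induction k) (simp_all only: funpow.simps comp_apply id_apply)
    moreover have "(\<lambda>r::nat. if r = 0 then M l j i else 0) = 0"
      using order_leD [OF assms that] by auto
    ultimately show ?thesis
      by simp
  qed
  then show "{i. (-1) ^ i * (Dx_comp ^^ i) (\<lambda>r. if r = 0 then M l j i else 0) n \<noteq> 0} \<subseteq> {..N}"
    by (auto intro!: leI)
qed simp

text \<open>Summing the coefficients of \<open>adj M\<close> back gives the form with the
  derivatives outside, which is the shape of \<open>tlin_adj\<close>. The order bound of
  \<open>M\<close> is also one for \<open>adj M\<close>.\<close>

lemma
  fixes M :: "('m::finite) cdiff"
  assumes M: "M \<in> cdiff_ops" and N: "order_le N M"
  shows adj_in_cdiff_ops: "adj M \<in> cdiff_ops"
    and app_adj_eq_sum: "\<psi> \<in> tuples \<Longrightarrow>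
      app (adj M) \<psi> j = (\<Sum>(l, k)\<in>UNIV \<times> {..N}. (-1) ^ k * (Dx ^^ k) (M l j k * \<psi> l))"
proof -
  let ?c = "\<lambda>l j i. (Dx_comp ^^ i) (\<lambda>r. if r = 0 then M l j i else 0)"
  have M_smooth: "M l j i \<in> smooth_fns" for l j i
    using M by (simp add: cdiff_ops_def)
  have c_smooth: "?c l j i n \<in> smooth_fns" and c_zero: "i < n \<Longrightarrow> ?c l j i n = 0" for l j i n
    using Dx_comp_funpow [OF M_smooth zero_in_smooth_fns] by blast+
  have "adj M j l n = 0" if "N < n" for j l n
    unfolding adj_eq_sum [OF N] using that by (intro sum.neutral) (simp add: c_zero)
  then have zero: "order_le N (adj M)"
    by (simp add: order_le_def)
  have "finite {n. adj M j l n \<noteq> 0}" for j l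
    by (rule finite_subset [of _ "{..N}"]) (auto intro!: leI simp: order_leD [OF zero])
  moreover have "adj M j l n \<in> smooth_fns" for j l n
    unfolding adj_eq_sum [OF N] by (intro smooth_intros c_smooth)
  ultimately show "adj M \<in> cdiff_ops"
    by (simp add: cdiff_ops_def)
  assume "\<psi> \<in> tuples"
  then have \<psi>: "\<psi> l \<in> smooth_fns" for l
    by (simp add: tuples_def)
  have inner: "(\<Sum>n\<le>N. adj M j l n * (Dx ^^ n) (\<psi> l)) =
      (\<Sum>i\<le>N. (-1) ^ i * (Dx ^^ i) (M l j i * \<psi> l))" for l
  proof -
    have "(\<Sum>n\<le>N. adj M j l n * (Dx ^^ n) (\<psi> l)) =
        (\<Sum>n\<le>N. \<Sum>i\<le>N. (-1) ^ i * (?c l j i n * (Dx ^^ n) (\<psi> l)))"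
      unfolding adj_eq_sum [OF N] sum_distrib_right mult.assoc ..
    also have "\<dots> = (\<Sum>i\<le>N. (-1) ^ i * (\<Sum>n\<le>N. ?c l j i n * (Dx ^^ n) (\<psi> l)))"
      unfolding sum_distrib_left by (rule sum.swap)
    also have "\<dots> = (\<Sum>i\<le>N. (-1) ^ i * (Dx ^^ i) (M l j i * \<psi> l))"
    proof (intro sum.cong refl arg_cong2 [of _ _ _ _ "(*)"])
      fix i
      assume "i \<in> {..N}"
      then have "(\<Sum>n\<le>N. ?c l j i n * (Dx ^^ n) (\<psi> l)) = (\<Sum>n\<le>i. ?c l j i n * (Dx ^^ n) (\<psi> l))"
        by (intro sum.mono_neutral_right) (auto simp: c_zero)
      then show "(\<Sum>n\<le>N. ?c l j i n * (Dx ^^ n) (\<psi> l)) = (Dx ^^ i) (M l j i * \<psi> l)"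
        using Dx_comp_funpow [OF M_smooth \<psi>] by simp
    qed
    finally show ?thesis .
  qed
  show "app (adj M) \<psi> j = (\<Sum>(l, k)\<in>UNIV \<times> {..N}. (-1) ^ k * (Dx ^^ k) (M l j k * \<psi> l))"
    unfolding app_eq_sum [OF zero] sum.cartesian_product [symmetric] inner ..
qed

section \<open>The correspondence between operators and functions\<close>

text \<open>
  \<open>G\<close> pairs the value of a monomial operator at fixed arguments with the corresponding monomial in
  the odd variables; \<open>corr G\<close> is its span over the functions on the equation.
\<close>

inductive corr :: "('m fn \<times> 'm gfun) set \<Rightarrow> 'm fn \<Rightarrow> 'm gfun \<Rightarrow> bool" for G where
  corr_zero: "corr G 0 0"
| corr_step: "a \<in> smooth_fns \<Longrightarrow> (g, \<gamma>) \<in> G \<Longrightarrow> corr G b F \<Longrightarrow> corr G (a * g + b) (smul a \<gamma> + F)"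

lemma corr_gen: "(g, \<gamma>) \<in> G \<Longrightarrow> corr G g \<gamma>"
  using corr_step [OF one_in_smooth_fns _ corr_zero, of g \<gamma> G] by simp

lemma corr_add:
  assumes "corr G b F" "corr G c H"
  shows "corr G (b + c) (F + H)"
  using assms(1)
proof (induction rule: corr.induct)
  case corr_zero
  show "corr G (0 + c) (0 + H)"
    using assms(2) by simp
next
  case (corr_step a g \<gamma> b F)
  then have "corr G (a * g + (b + c)) (smul a \<gamma> + (F + H))"
    by (intro corr.corr_step)
  then show "corr G (a * g + b + c) (smul a \<gamma> + F + H)"
    by (simp only: add.assoc)
qed

lemma corr_scale:
  assumes "a \<in> smooth_fns" "corr G b F"
  shows "corr G (a * b) (smul a F)"
  using assms(2)
proof (induction rule: corr.induct)
  case corr_zero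
  show "corr G (a * 0) (smul a 0)"
    by (simp add: corr.corr_zero)
next
  case (corr_step r g \<gamma> b F)
  then have "corr G (a * r * g + a * b) (smul (a * r) \<gamma> + smul a F)"
    by (intro corr.corr_step mult_in_smooth_fns assms(1))
  then show "corr G (a * (r * g + b)) (smul a (smul r \<gamma> + F))"
    by (simp only: distrib_left smul_add_right smul_smul mult.assoc)
qed

lemma corr_minus: "corr G b F \<Longrightarrow> corr G (- b) (- F)"
  using corr_scale [OF minus_one_in_smooth_fns, of G b F] by (simp add: smul_minus_one)

lemma corr_diff: "corr G b F \<Longrightarrow> corr G c H \<Longrightarrow> corr G (b - c) (F - H)"
  using corr_add [OF _ corr_minus] by fastforce

lemma corr_sum:
  assumes "\<And>x. x \<in> J \<Longrightarrow> corr G (b x) (F x)"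
  shows "corr G (sum b J) (sum F J)"
  using assms
proof (induction J rule: infinite_finite_induct)
  case (infinite J)
  then show "corr G (sum b J) (sum F J)"
    by (simp add: corr_zero)
next
  case empty
  show "corr G (sum b {}) (sum F {})"
    by (simp add: corr_zero)
next
  case (insert x J)
  then show "corr G (sum b (insert x J)) (sum F (insert x J))"
    by (simp add: corr_add)
qed

text \<open>Scalars are even and pass both factors freely, so the product is determined on
  generators. The factor \<open>r\<close> records the sign found there: \<open>1\<close> for pq and
  \<open>- 1\<close> for qp.\<close>

lemma corr_gmul:
  assumes gens: "\<And>g \<gamma> h \<delta>. (g, \<gamma>) \<in> G \<Longrightarrow> (h, \<delta>) \<in> G' \<Longrightarrow> corr G'' (r * (g * h)) (\<gamma> \<bullet>\<^sub>g \<delta>)"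
    and "corr G b F" "corr G' c H"
  shows "corr G'' (r * (b * c)) (F \<bullet>\<^sub>g H)"
  using assms(2)
proof (induction rule: corr.induct)
  case corr_zero
  show "corr G'' (r * (0 * c)) (0 \<bullet>\<^sub>g H)"
    by (simp add: corr.corr_zero)
next
  case (corr_step a g \<gamma> b F)
  have "corr G'' (r * (g * c)) (\<gamma> \<bullet>\<^sub>g H)"
    using assms(3)
  proof (induction rule: corr.induct)
    case corr_zero
    show "corr G'' (r * (g * 0)) (\<gamma> \<bullet>\<^sub>g 0)"
      by (simp add: corr.corr_zero)
  next
    case (corr_step a' h \<delta> c H)
    have "corr G'' (a' * (r * (g * h)) + r * (g * c)) (smul a' (\<gamma> \<bullet>\<^sub>g \<delta>) + \<gamma> \<bullet>\<^sub>g H)"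
      by (intro corr_add [OF corr_scale] gens \<open>(g, \<gamma>) \<in> G\<close> corr_step)
    moreover have "r * (g * (a' * h + c)) = a' * (r * (g * h)) + r * (g * c)"
      by (simp only: distrib_left mult.assoc mult.left_commute)
    ultimately show "corr G'' (r * (g * (a' * h + c))) (\<gamma> \<bullet>\<^sub>g (smul a' \<delta> + H))"
      by (simp only: gmul_add_right gmul_smul_right)
  qed
  then have "corr G'' (a * (r * (g * c)) + r * (b * c)) (smul a (\<gamma> \<bullet>\<^sub>g H) + F \<bullet>\<^sub>g H)"
    using corr_step by (intro corr_add corr_scale)
  moreover have "r * ((a * g + b) * c) = a * (r * (g * c)) + r * (b * c)"
    by (simp only: distrib_left distrib_right mult.assoc mult.left_commute)
  ultimately show "corr G'' (r * ((a * g + b) * c)) ((smul a \<gamma> + F) \<bullet>\<^sub>g H)"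
    by (simp only: gmul_add_left gmul_smul_left)
qed

section \<open>Compatibility of the correspondence with total derivatives\<close>

definition tDx_closed :: "(('m::linorder) fn \<times> 'm gfun) set \<Rightarrow> bool" where
  "tDx_closed G \<longleftrightarrow>
     (\<forall>g \<gamma>. (g, \<gamma>) \<in> G \<longrightarrow> g \<in> smooth_fns \<and> \<gamma> \<in> fin_gfuns \<and> corr G (Dx g) (tDx \<gamma>))"

lemma corr_smooth_finite:
  assumes "tDx_closed G" "corr G b F"
  shows "b \<in> smooth_fns \<and> F \<in> fin_gfuns"
  using assms(2)
proof (induction rule: corr.induct)
  case corr_zero
  show "0 \<in> smooth_fns \<and> 0 \<in> fin_gfuns"
    by (simp add: zero_in_smooth_fns zero_in_fin_gfuns)
next
  case (corr_step a g \<gamma> b F)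
  then show "a * g + b \<in> smooth_fns \<and> smul a \<gamma> + F \<in> fin_gfuns"
    using assms(1) unfolding tDx_closed_def
    by (blast intro: add_in_smooth_fns mult_in_smooth_fns add_in_fin_gfuns smul_in_fin_gfuns)
qed

text \<open>The condition on generators spreads to their span because both derivatives obey the same
  Leibniz rule over scalars; the smoothness and finiteness clauses of \<open>tDx_closed\<close> make
  \<open>Dx_mult\<close> and \<open>tDx_smul\<close> applicable.\<close>

lemma corr_Dx:
  assumes "tDx_closed G" "corr G b F"
  shows "corr G (Dx b) (tDx F)"
  using assms(2)
proof (induction rule: corr.induct)
  case corr_zero
  have "tDx 0 + tDx 0 = tDx (0 + 0 :: 'a gfun)"
    by (intro tDx_add [symmetric] zero_in_fin_gfuns)
  then show "corr G (Dx 0) (tDx 0)"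
    by (simp add: corr.corr_zero)
next
  case (corr_step a g \<gamma> b F)
  then have gen: "g \<in> smooth_fns" "\<gamma> \<in> fin_gfuns" "corr G (Dx g) (tDx \<gamma>)"
    using assms(1) unfolding tDx_closed_def by blast+
  have tail: "b \<in> smooth_fns" "F \<in> fin_gfuns"
    using corr_smooth_finite [OF assms(1) corr_step(3)] by blast+
  have "corr G (Dx a * g + a * Dx g + Dx b) (smul (Dx a) \<gamma> + smul a (tDx \<gamma>) + tDx F)"
    by (intro corr_add [OF corr_add [OF corr_scale corr_scale]] corr_gen Dx_in_smooth_fns
        corr_step(1,2,4) gen(3))
  moreover have "Dx (a * g + b) = Dx a * g + a * Dx g + Dx b"
    by (simp only: Dx_add Dx_mult mult_in_smooth_fns corr_step(1) gen tail)
  moreover have "tDx (smul a \<gamma> + F) = smul (Dx a) \<gamma> + smul a (tDx \<gamma>) + tDx F"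
    by (simp only: tDx_add tDx_smul smul_in_fin_gfuns corr_step(1) gen tail)
  ultimately show "corr G (Dx (a * g + b)) (tDx (smul a \<gamma> + F))"
    by (simp only:)
qed

lemma corr_Dx_funpow:
  assumes "tDx_closed G" "corr G b F"
  shows "corr G ((Dx ^^ k) b) ((tDx ^^ k) F)"
proof (induction k)
  case (Suc k)
  then show "corr G ((Dx ^^ Suc k) b) ((tDx ^^ Suc k) F)"
    by (simp add: corr_Dx assms(1))
qed (simp add: assms(2))

text \<open>\<open>V\<close> will be \<open>Pvar\<close> or \<open>Qvar\<close>, which handles both
  coverings at once.\<close>

definition lin_gens ::
  "('m \<Rightarrow> nat \<Rightarrow> 'm odd_var) \<Rightarrow> ('m \<Rightarrow> 'm fn) \<Rightarrow> ('m fn \<times> 'm gfun) set" where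
  "lin_gens V \<psi> = {((Dx ^^ i) (\<psi> a), gen (V a i)) | a i. True}"

definition bilin_gens ::
  "(('m::linorder) \<Rightarrow> 'm fn) \<Rightarrow> ('m \<Rightarrow> 'm fn) \<Rightarrow> ('m fn \<times> 'm gfun) set" where
  "bilin_gens \<psi> \<phi> =
     {((Dx ^^ i) (\<psi> a) * (Dx ^^ j) (\<phi> b), pvar a i \<bullet>\<^sub>g qvar b j) | a i b j. True}"

lemma tDx_closed_lin_gens:
  assumes "\<psi> \<in> tuples" and V: "\<And>a i. tDx (gen (V a i)) = gen (V a (Suc i))"
  shows "tDx_closed (lin_gens V \<psi>)"
proof -
  have "corr (lin_gens V \<psi>) (Dx ((Dx ^^ i) (\<psi> a))) (gen (V a (Suc i)))" for a i
    by (rule corr_gen) (auto simp: lin_gens_def intro!: exI [of _ "Suc i"])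
  moreover have "(Dx ^^ i) (\<psi> a) \<in> smooth_fns" for a i
    using assms(1) by (simp add: tuples_def Dx_funpow_in_smooth_fns)
  ultimately show ?thesis
    unfolding tDx_closed_def lin_gens_def by (auto simp: V gen_in_fin_gfuns)
qed

text \<open>Stability holds because \<open>tDx_pvar_gmul_qvar\<close> has the same shape as the
  Leibniz rule for \<open>Dx\<close>.\<close>

lemma tDx_closed_bilin_gens:
  assumes "\<psi> \<in> tuples" "\<phi> \<in> tuples"
  shows "tDx_closed (bilin_gens \<psi> \<phi>)"
proof -
  have smooth: "(Dx ^^ i) (\<psi> a) \<in> smooth_fns" "(Dx ^^ i) (\<phi> a) \<in> smooth_fns" for a i
    using assms by (simp_all add: tuples_def Dx_funpow_in_smooth_fns)
  have gen: "corr (bilin_gens \<psi> \<phi>) ((Dx ^^ i) (\<psi> a) * (Dx ^^ j) (\<phi> b)) (pvar a i \<bullet>\<^sub>g qvar b j)" for a i b j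
    by (rule corr_gen) (auto simp: bilin_gens_def)
  have "corr (bilin_gens \<psi> \<phi>) (Dx ((Dx ^^ i) (\<psi> a) * (Dx ^^ j) (\<phi> b))) (tDx (pvar a i \<bullet>\<^sub>g qvar b j))"
    for a i b j
    using corr_add [OF gen [of "Suc i" a j b] gen [of i a "Suc j" b]]
    by (simp add: Dx_mult smooth tDx_pvar_gmul_qvar)
  then show ?thesis
    unfolding tDx_closed_def bilin_gens_def
    by (auto simp: smooth mult_in_smooth_fns pvar_gmul_qvar_in_fin_gfuns)
qed

section \<open>Linear functions and their linearizations\<close>

definition lin_fun ::
  "('m \<Rightarrow> nat \<Rightarrow> ('m::linorder) odd_var) \<Rightarrow> 'm cdiff \<Rightarrow> 'm \<Rightarrow> 'm gfun" where
  "lin_fun V A l = Sum_any (\<lambda>(j, i). gconst (A l j i) \<bullet>\<^sub>g gen (V j i))"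

lemma H_fun_eq_lin_fun: "H_fun = lin_fun Pvar"
  by (simp add: fun_eq_iff H_fun_def lin_fun_def)

lemma N_fun_eq_lin_fun: "N_fun = lin_fun Qvar"
  by (simp add: fun_eq_iff N_fun_def lin_fun_def)

lemma gconst_gmul_gen: "gconst a \<bullet>\<^sub>g gen g = smul a (gen g)"
  by (rule gconst_gmul) (rule gen_infinite)

lemma lin_fun_eq_sum:
  fixes A :: "('m::{finite,linorder}) cdiff"
  assumes "order_le N A"
  shows "lin_fun V A l = (\<Sum>(j, i)\<in>UNIV \<times> {..N}. smul (A l j i) (gen (V j i)))"
  unfolding lin_fun_def gconst_gmul_gen
  by (rule Sum_any_eq_sum_Times) (simp add: order_leD [OF assms])

lemma tDx_zero [simp]: "tDx 0 = 0"
  using tDx_add [OF zero_in_fin_gfuns zero_in_fin_gfuns] by simp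

lemma tDx_funpow_zero: "(tDx ^^ k) 0 = 0"
  by (induction k) (simp_all only: funpow.simps comp_apply id_apply tDx_zero)

lemma gpd_zero [simp]: "gpd c 0 = 0"
  by (simp add: gpd_def fun_eq_iff)

lemma gpd_add:
  assumes "F \<in> fin_gfuns" "G \<in> fin_gfuns"
  shows "gpd c (F + G) = gpd c F + gpd c G"
  using assms by (simp add: gpd_def fin_gfuns_def pd_add plus_fun_def [of "\<lambda>S. pd c (F S)"])

lemma sum_in_fin_gfuns: "(\<And>x. x \<in> J \<Longrightarrow> F x \<in> fin_gfuns) \<Longrightarrow> sum F J \<in> fin_gfuns"
  by (induction J rule: infinite_finite_induct) (auto intro: zero_in_fin_gfuns add_in_fin_gfuns)

lemma gpd_sum:
  assumes "\<And>x. x \<in> J \<Longrightarrow> F x \<in> fin_gfuns"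
  shows "gpd c (sum F J) = (\<Sum>x\<in>J. gpd c (F x))"
  using assms
proof (induction J rule: infinite_finite_induct)
  case (insert x J)
  then show "gpd c (sum F (insert x J)) = (\<Sum>x\<in>insert x J. gpd c (F x))"
    by (simp add: gpd_add sum_in_fin_gfuns)
qed auto

lemma gpd_smul_gen: "gpd c (smul a (gen g)) = smul (pd c a) (gen g)"
  by (auto simp: gpd_def smul_def gen_def)

lemma gpd_lin_fun_eq_sum:
  fixes A :: "('m::{finite,linorder}) cdiff"
  assumes "A \<in> cdiff_ops" "order_le N A"
  shows "gpd c (lin_fun V A l) = (\<Sum>(j, i)\<in>UNIV \<times> {..N}. smul (pd c (A l j i)) (gen (V j i)))"
proof -
  have "smul (A l j i) (gen (V j i)) \<in> fin_gfuns" for j i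
    using assms(1) by (simp add: cdiff_ops_def smul_in_fin_gfuns gen_in_fin_gfuns)
  then show ?thesis
    unfolding lin_fun_eq_sum [OF assms(2)] case_prod_unfold by (simp only: gpd_sum gpd_smul_gen)
qed

lemma corr_lin_fun:
  fixes A :: "('m::{finite,linorder}) cdiff"
  assumes "A \<in> cdiff_ops"
  shows "corr (lin_gens V \<psi>) (app A \<psi> l) (lin_fun V A l)"
proof -
  obtain N where N: "order_le N A"
    using cdiff_ops_order_le [OF assms] .
  show ?thesis
    unfolding app_eq_sum [OF N] lin_fun_eq_sum [OF N] case_prod_unfold
    using assms by (intro corr_sum corr_scale corr_gen) (auto simp: cdiff_ops_def lin_gens_def)
qed

text \<open>An even derivative leaves the odd variables alone, so both sides are built from the same
  coefficients \<open>pd (Uc j k) (A l b i)\<close>. This relates the linearization entry by entry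
  to the lifted one.\<close>

lemma corr_gpd_lin_fun:
  fixes A :: "('m::{finite,linorder}) cdiff"
  assumes "A \<in> cdiff_ops"
  shows "corr (lin_gens V \<psi>) (lin_mat A \<psi> l j k) (gpd (Uc j k) (lin_fun V A l))"
proof -
  obtain N where N: "order_le N A"
    using cdiff_ops_order_le [OF assms] .
  show ?thesis
    unfolding lin_mat_eq_sum [OF N] gpd_lin_fun_eq_sum [OF assms N] case_prod_unfold
    using assms
    by (intro corr_sum corr_scale corr_gen) (auto simp: cdiff_ops_def lin_gens_def pd_in_smooth_fns)
qed

text \<open>A single bound, independent of \<open>\<psi>\<close> and \<open>V\<close>, makes
  \<open>app (lin_mat A \<psi>)\<close> and \<open>tlin (lin_fun V A)\<close> sums over the same
  indices.\<close>

lemma linearization_order_le: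
  fixes A :: "('m::{finite,linorder}) cdiff"
  assumes "A \<in> cdiff_ops"
  obtains N where "\<And>\<psi>. order_le N (lin_mat A \<psi>)"
    "\<And>V l j k. N < k \<Longrightarrow> gpd (Uc j k) (lin_fun V A l) = 0"
proof -
  obtain M where M: "order_le M A"
    using cdiff_ops_order_le [OF assms] .
  obtain N where N: "\<And>l b i j k. N < k \<Longrightarrow> pd (Uc j k) (A l b i) = 0"
    using pd_coeff_bound [OF assms] by metis
  show thesis
  proof (rule that)
    show "order_le N (lin_mat A \<psi>)" for \<psi>
      unfolding order_le_def lin_mat_def by (simp add: N)
    show "gpd (Uc j k) (lin_fun V A l) = 0" if "N < k" for V l j k
      unfolding gpd_lin_fun_eq_sum [OF assms M] by (intro sum.neutral) (auto simp: N [OF that])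
  qed
qed

section \<open>Correspondence for the single terms of the bracket\<close>

lemma corr_tapp:
  fixes A :: "('m::{finite,linorder}) cdiff"
  assumes "A \<in> cdiff_ops" "tDx_closed G" "\<And>j. corr G (x j) (X j)"
  shows "corr G (app A x l) (tapp A X l)"
proof -
  obtain N where N: "order_le N A"
    using cdiff_ops_order_le [OF assms(1)] .
  have X: "corr G ((Dx ^^ i) (x j)) ((tDx ^^ i) (X j))" for j i
    by (intro corr_Dx_funpow assms)
  \<comment> \<open>Membership in \<open>fin_gfuns\<close> supplies the vanishing at infinite sets
    that turns \<open>gconst\<close> into a scalar.\<close>
  then have "\<And>S. infinite S \<Longrightarrow> (tDx ^^ i) (X j) S = 0" for j i
    using corr_smooth_finite [OF assms(2) X] by (simp add: fin_gfuns_def)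
  then have "gconst (A l j i) \<bullet>\<^sub>g (tDx ^^ i) (X j) = smul (A l j i) ((tDx ^^ i) (X j))" for j i
    by (rule gconst_gmul)
  then have "tapp A X l = (\<Sum>(j, i)\<in>UNIV \<times> {..N}. smul (A l j i) ((tDx ^^ i) (X j)))"
    unfolding tapp_def by (simp only:) (rule Sum_any_eq_sum_Times, simp add: order_leD [OF N])
  then show ?thesis
    unfolding app_eq_sum [OF N] case_prod_unfold
    using assms(1) X by (auto intro!: corr_sum corr_scale simp: cdiff_ops_def)
qed

text \<open>By \<open>lin_op_eq_app_lin_mat\<close> the operator is a sum of entries times
  derivatives of the argument, which matches \<open>tlin\<close> term by term. The factor
  \<open>r\<close> depends on which of the two linear functions stands on the left.\<close>

lemma corr_tlin:
  fixes A :: "('m::{finite,linorder}) cdiff"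
  assumes "A \<in> cdiff_ops" "tDx_closed G" "\<And>j. corr G (x j) (X j)"
    and gens: "\<And>g \<gamma> h \<delta>. (g, \<gamma>) \<in> lin_gens V \<psi> \<Longrightarrow> (h, \<delta>) \<in> G \<Longrightarrow>
      corr G' (r * (g * h)) (\<gamma> \<bullet>\<^sub>g \<delta>)"
  shows "corr G' (r * lin_op A \<psi> x l) (tlin (lin_fun V A) X l)"
proof -
  obtain N where N: "order_le N (lin_mat A \<psi>)"
    and zero: "\<And>l j k. N < k \<Longrightarrow> gpd (Uc j k) (lin_fun V A l) = 0"
    using linearization_order_le [OF assms(1)] by metis
  have "corr G' (r * (lin_mat A \<psi> l j k * (Dx ^^ k) (x j)))
      (gpd (Uc j k) (lin_fun V A l) \<bullet>\<^sub>g (tDx ^^ k) (X j))" for j k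
    by (rule corr_gmul [OF _ corr_gpd_lin_fun [OF assms(1)] corr_Dx_funpow [OF assms(2,3)]])
      (rule gens; assumption)
  moreover have "tlin (lin_fun V A) X l =
      (\<Sum>(j, k)\<in>UNIV \<times> {..N}. gpd (Uc j k) (lin_fun V A l) \<bullet>\<^sub>g (tDx ^^ k) (X j))"
    unfolding tlin_def by (rule Sum_any_eq_sum_Times) (simp add: zero)
  ultimately show ?thesis
    unfolding lin_op_eq_app_lin_mat [OF assms(1)] app_eq_sum [OF N] sum_distrib_left case_prod_unfold
    by (simp only:) (rule corr_sum)
qed

lemma corr_pvar_qvar:
  "(g, \<gamma>) \<in> lin_gens Pvar \<psi> \<Longrightarrow> (h, \<delta>) \<in> lin_gens Qvar \<phi> \<Longrightarrow>
    corr (bilin_gens \<psi> \<phi>) (1 * (g * h)) (\<gamma> \<bullet>\<^sub>g \<delta>)"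
  by (auto simp: lin_gens_def bilin_gens_def intro!: corr_gen)

text \<open>The values commute while the odd generators anticommute, which is where the sign changes
  between the two formulas come from.\<close>

lemma corr_qvar_pvar:
  assumes "(g, \<gamma>) \<in> lin_gens Qvar \<phi>" "(h, \<delta>) \<in> lin_gens Pvar \<psi>"
  shows "corr (bilin_gens \<psi> \<phi>) (- 1 * (g * h)) (\<gamma> \<bullet>\<^sub>g \<delta>)"
proof -
  have "\<gamma> \<bullet>\<^sub>g \<delta> = - (\<delta> \<bullet>\<^sub>g \<gamma>)"
    using assms by (auto simp: lin_gens_def intro: gen_anticommute)
  with corr_minus [OF corr_pvar_qvar [OF assms(2,1)]] show ?thesis
    by (simp add: mult.commute)
qed

text \<open>The q-linear derivative of \<open>lin_fun Qvar R\<close> stands before p, which produces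
  the minus sign. From there on everything is bilinear, so \<open>tDx ^^ k\<close> is matched with
  \<open>Dx ^^ k\<close>, and \<open>app_adj_eq_sum\<close> recognizes the adjoint.\<close>

lemma corr_tlin_adj:
  fixes R :: "('m::{finite,linorder}) cdiff"
  assumes "R \<in> cdiff_ops" "\<psi> \<in> tuples" "\<phi> \<in> tuples"
  shows "corr (bilin_gens \<psi> \<phi>) (- lin_op_adj R \<phi> \<psi> j) (tlin_adj (lin_fun Qvar R) p_tuple j)"
proof -
  let ?M = "lin_mat R \<phi>" and ?G = "bilin_gens \<psi> \<phi>"
  have M: "?M \<in> cdiff_ops"
    by (intro lin_mat_in_cdiff_ops assms)
  obtain N where N: "order_le N ?M"
    and zero: "\<And>V l j k. N < k \<Longrightarrow> gpd (Uc j k) (lin_fun V R l) = 0"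
    using linearization_order_le [OF assms(1)] by metis
  have prod_smooth: "?M l j k * \<psi> l \<in> smooth_fns" for l k
    using M assms(2) by (simp add: cdiff_ops_def tuples_def mult_in_smooth_fns)
  have p: "corr (lin_gens Pvar \<psi>) (\<psi> l) (p_tuple l)" for l
    by (rule corr_gen) (auto simp: lin_gens_def p_tuple_def intro!: exI [of _ 0])
  have "corr ?G (- 1 * (?M l j k * \<psi> l)) (gpd (Uc j k) (lin_fun Qvar R l) \<bullet>\<^sub>g p_tuple l)" for l k
    by (rule corr_gmul [OF _ corr_gpd_lin_fun [OF assms(1)] p]) (rule corr_qvar_pvar; assumption)
  then have "corr ?G (- (?M l j k * \<psi> l)) (gpd (Uc j k) (lin_fun Qvar R l) \<bullet>\<^sub>g p_tuple l)" for l k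
    by (simp only: mult_minus1)
  then have "corr ?G ((Dx ^^ k) (- (?M l j k * \<psi> l)))
      ((tDx ^^ k) (gpd (Uc j k) (lin_fun Qvar R l) \<bullet>\<^sub>g p_tuple l))" for l k
    by (intro corr_Dx_funpow tDx_closed_bilin_gens assms)
  then have "corr ?G (- ((Dx ^^ k) (?M l j k * \<psi> l)))
      ((tDx ^^ k) (gpd (Uc j k) (lin_fun Qvar R l) \<bullet>\<^sub>g p_tuple l))" for l k
    by (simp only: Dx_funpow_minus prod_smooth)
  then have "corr ?G ((- 1) ^ k * - ((Dx ^^ k) (?M l j k * \<psi> l)))
      ((- 1) ^ k * (tDx ^^ k) (gpd (Uc j k) (lin_fun Qvar R l) \<bullet>\<^sub>g p_tuple l))" for l k
    unfolding smul_power_minus_one [symmetric]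
    by (intro corr_scale power_in_smooth_fns minus_one_in_smooth_fns)
  then have "corr ?G (\<Sum>(l, k)\<in>UNIV \<times> {..N}. (- 1) ^ k * - ((Dx ^^ k) (?M l j k * \<psi> l)))
      (\<Sum>(l, k)\<in>UNIV \<times> {..N}.
        (- 1) ^ k * (tDx ^^ k) (gpd (Uc j k) (lin_fun Qvar R l) \<bullet>\<^sub>g p_tuple l))"
    unfolding case_prod_unfold by (rule corr_sum)
  moreover have "(\<Sum>(l, k)\<in>UNIV \<times> {..N}. (- 1) ^ k * - ((Dx ^^ k) (?M l j k * \<psi> l))) =
      - lin_op_adj R \<phi> \<psi> j"
    unfolding lin_op_adj_def app_adj_eq_sum [OF M N assms(2)] case_prod_unfold
    by (simp add: sum_negf)
  moreover have "tlin_adj (lin_fun Qvar R) p_tuple j = (\<Sum>(l, k)\<in>UNIV \<times> {..N}.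
        (- 1) ^ k * (tDx ^^ k) (gpd (Uc j k) (lin_fun Qvar R l) \<bullet>\<^sub>g p_tuple l))"
    unfolding tlin_adj_def by (intro Sum_any_eq_sum_Times) (simp add: zero tDx_funpow_zero)
  ultimately show ?thesis
    by (simp only:)
qed

text \<open>The second term under \<open>A\<close> in the bracket is thus the linearization of a
  p-linear function, that of \<open>adj R\<close>, and falls under \<open>corr_tlin\<close>.\<close>

lemma lin_fun_Pvar_eq_tapp: "lin_fun Pvar A = tapp A p_tuple"
  by (simp add: fun_eq_iff lin_fun_def tapp_def p_tuple_def tDx_funpow_pvar)

lemma app_minus:
  fixes A :: "('m::finite) cdiff"
  assumes "A \<in> cdiff_ops" "\<And>j. x j \<in> smooth_fns"
  shows "app A (- x) l = - app A x l"
proof -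
  obtain N where N: "order_le N A"
    using cdiff_ops_order_le [OF assms(1)] .
  show ?thesis
    unfolding app_eq_sum [OF N] by (simp add: Dx_funpow_minus assms(2) sum_negf case_prod_unfold)
qed

lemma corr_bracket:
  fixes A R :: "('m::{finite,linorder}) cdiff"
  assumes A: "A \<in> cdiff_ops" and R: "R \<in> cdiff_ops" and \<psi>: "\<psi> \<in> tuples" and \<phi>: "\<phi> \<in> tuples"
  shows "corr (bilin_gens \<psi> \<phi>) (Cstar A R \<psi> \<phi> l) (bracket A R l)"
proof -
  let ?G = "bilin_gens \<psi> \<phi>"
  have P: "tDx_closed (lin_gens Pvar \<psi>)" and Q: "tDx_closed (lin_gens Qvar \<phi>)"
    and PQ: "tDx_closed ?G"
    by (intro tDx_closed_lin_gens tDx_closed_bilin_gens \<psi> \<phi> tDx_pvar tDx_qvar)+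
  have adj_R: "adj R \<in> cdiff_ops"
    using cdiff_ops_order_le [OF R] adj_in_cdiff_ops [OF R] by metis
  have q: "corr (lin_gens Qvar \<phi>) (\<phi> j) (q_tuple j)" for j
    by (rule corr_gen) (auto simp: lin_gens_def q_tuple_def intro!: exI [of _ 0])
  have PQ_tlin: "corr ?G (lin_op B \<psi> x l) (tlin (lin_fun Pvar B) X l)"
    if "B \<in> cdiff_ops" "\<And>j. corr (lin_gens Qvar \<phi>) (x j) (X j)" for B x X l
  proof -
    have "corr ?G (1 * lin_op B \<psi> x l) (tlin (lin_fun Pvar B) X l)"
      by (rule corr_tlin [OF that(1) Q that(2)]) (rule corr_pvar_qvar; assumption)
    then show ?thesis
      by simp
  qed
  have "corr ?G (- 1 * lin_op R \<phi> (app A \<psi>) l) (tlin (N_fun R) (H_fun A) l)"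
    unfolding N_fun_eq_lin_fun H_fun_eq_lin_fun
    by (rule corr_tlin [OF R P corr_lin_fun [OF A]]) (rule corr_qvar_pvar; assumption)
  moreover have "corr ?G (lin_op A \<psi> (app R \<phi>) l) (tlin (H_fun A) (N_fun R) l)"
    unfolding N_fun_eq_lin_fun H_fun_eq_lin_fun
    by (intro PQ_tlin A corr_lin_fun [OF R])
  moreover have "corr ?G (app R (lin_op A \<psi> \<phi>) l) (tapp R (tlin (H_fun A) q_tuple) l)"
  proof (intro corr_tapp R PQ)
    show "corr ?G (lin_op A \<psi> \<phi> j) (tlin (H_fun A) q_tuple j)" for j
      using PQ_tlin [OF A q] by (simp add: H_fun_eq_lin_fun)
  qed
  \<comment> \<open>Only the first of the two terms changes sign, so their sum matches the negative
    of the difference in \<open>Cstar\<close>.\<close>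
  moreover have adj_diff: "corr ?G ((- (lin_op_adj R \<phi> \<psi> - lin_op (adj R) \<psi> \<phi>)) j)
      ((tlin_adj (N_fun R) p_tuple + tlin (tapp (adj R) p_tuple) q_tuple) j)" for j
  proof -
    have "corr ?G (lin_op (adj R) \<psi> \<phi> j) (tlin (tapp (adj R) p_tuple) q_tuple j)"
      using PQ_tlin [OF adj_R q] by (simp add: lin_fun_Pvar_eq_tapp)
    with corr_tlin_adj [OF R \<psi> \<phi>]
    have "corr ?G (- lin_op_adj R \<phi> \<psi> j + lin_op (adj R) \<psi> \<phi> j)
      (tlin_adj (lin_fun Qvar R) p_tuple j + tlin (tapp (adj R) p_tuple) q_tuple j)"
      by (rule corr_add)
    then show ?thesis
      by (simp add: N_fun_eq_lin_fun)
  qed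
  then have "corr ?G (app A (- (lin_op_adj R \<phi> \<psi> - lin_op (adj R) \<psi> \<phi>)) l)
      (tapp A (tlin_adj (N_fun R) p_tuple + tlin (tapp (adj R) p_tuple) q_tuple) l)"
    by (intro corr_tapp A PQ)
  moreover have "app A (- (lin_op_adj R \<phi> \<psi> - lin_op (adj R) \<psi> \<phi>)) l =
      - app A (lin_op_adj R \<phi> \<psi> - lin_op (adj R) \<psi> \<phi>) l"
  proof (rule app_minus [OF A])
    fix j
    \<comment> \<open>The negated tuple is smooth because it occurs in a correspondence; negating it
      once more gives the claim.\<close>
    show "(lin_op_adj R \<phi> \<psi> - lin_op (adj R) \<psi> \<phi>) j \<in> smooth_fns"
      using corr_smooth_finite [OF PQ adj_diff] minus_in_smooth_fns by fastforce
  qed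
  \<comment> \<open>The two negated values meet the minus signs of the bracket and turn into the
    plus signs of \<open>Cstar\<close>.\<close>
  ultimately have "corr ?G
      (- (- 1 * lin_op R \<phi> (app A \<psi>) l) - lin_op A \<psi> (app R \<phi>) l
       - - app A (lin_op_adj R \<phi> \<psi> - lin_op (adj R) \<psi> \<phi>) l + app R (lin_op A \<psi> \<phi>) l)
      (- tlin (N_fun R) (H_fun A) l - tlin (H_fun A) (N_fun R) l
       - tapp A (tlin_adj (N_fun R) p_tuple + tlin (tapp (adj R) p_tuple) q_tuple) l
       + tapp R (tlin (H_fun A) q_tuple) l)"
    by (intro corr_add corr_diff corr_minus) simp_all
  then show ?thesis
    by (simp add: Cstar_def bracket_def algebra_simps)
qed

section \<open>Extraction of coefficients\<close>

lemma doubleton_eq: "{Pvar a i, Qvar b j} = {Pvar a' i', Qvar b' j'} \<longleftrightarrow> a = a' \<and> i = i' \<and> b = b' \<and> j = j'"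
  by (auto simp: doubleton_eq_iff)

text \<open>Only the coefficients at pairs pq are read, which makes the substitution a function of
  the Grassmann element, where \<open>corr\<close> is a relation.\<close>

definition bilin_eval :: "('m \<Rightarrow> 'm fn) \<Rightarrow> ('m \<Rightarrow> 'm fn) \<Rightarrow> 'm gfun \<Rightarrow> 'm fn" where
  "bilin_eval \<psi> \<phi> F =
     Sum_any (\<lambda>(a, b, i, j). F {Pvar a i, Qvar b j} * (Dx ^^ i) (\<psi> a) * (Dx ^^ j) (\<phi> b))"

lemma finite_bilin_coeffs:
  assumes "F \<in> fin_gfuns"
  shows "finite {(a, b, i, j). F {Pvar a i, Qvar b j} \<noteq> 0}"
proof -
  have "inj (\<lambda>(a, b, i, j). {Pvar a i, Qvar b j} :: 'a odd_var set)"
    by (auto simp: inj_def doubleton_eq)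
  moreover have "finite {S. F S \<noteq> 0}"
    using assms by (simp add: fin_gfuns_def)
  ultimately have "finite ((\<lambda>(a, b, i, j). {Pvar a i, Qvar b j}) -` {S. F S \<noteq> 0})"
    by (intro finite_vimageI)
  then show ?thesis
    by (simp add: vimage_def case_prod_unfold)
qed

lemma bilin_eval_add:
  assumes "F \<in> fin_gfuns" "G \<in> fin_gfuns"
  shows "bilin_eval \<psi> \<phi> (F + G) = bilin_eval \<psi> \<phi> F + bilin_eval \<psi> \<phi> G"
proof -
  let ?t = "\<lambda>F (a, b, i, j). F {Pvar a i, Qvar b j} * (Dx ^^ i) (\<psi> a) * (Dx ^^ j) (\<phi> b)"
  have "finite {x. ?t H x \<noteq> 0}" if "H \<in> fin_gfuns" for H
    by (rule finite_subset [OF _ finite_bilin_coeffs [OF that]]) auto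
  then have "Sum_any (\<lambda>x. ?t F x + ?t G x) = Sum_any (?t F) + Sum_any (?t G)"
    using assms by (intro Sum_any.distrib)
  moreover have "?t (F + G) = (\<lambda>x. ?t F x + ?t G x)"
    by (rule ext) (simp only: case_prod_unfold plus_fun_apply [of F G] distrib_right)
  ultimately show ?thesis
    unfolding bilin_eval_def by (simp only:)
qed

lemma bilin_eval_gen:
  "bilin_eval \<psi> \<phi> (smul r (pvar a i \<bullet>\<^sub>g qvar b j)) = r * ((Dx ^^ i) (\<psi> a) * (Dx ^^ j) (\<phi> b))"
proof -
  let ?t = "\<lambda>(a', b', i', j'). smul r (pvar a i \<bullet>\<^sub>g qvar b j) {Pvar a' i', Qvar b' j'} *
    (Dx ^^ i') (\<psi> a') * (Dx ^^ j') (\<phi> b')"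
  have "Sum_any ?t = sum ?t {(a, b, i, j)}"
    by (rule Sum_any.expand_superset)
      (auto simp: smul_def pvar_gmul_qvar doubleton_eq split: if_splits)
  then show ?thesis
    by (simp add: bilin_eval_def smul_def pvar_gmul_qvar mult.assoc)
qed

text \<open>The value is determined by the function alone, however it was built up in
  \<open>corr\<close>. As the bracket involves neither \<open>\<psi>\<close> nor
  \<open>\<phi>\<close>, its coefficients will serve for all arguments.\<close>

lemma corr_bilin_gens:
  assumes "\<psi> \<in> tuples" "\<phi> \<in> tuples" "corr (bilin_gens \<psi> \<phi>) b F"
  shows "b = bilin_eval \<psi> \<phi> F \<and> (\<forall>S. F S \<noteq> 0 \<longrightarrow> (\<exists>a i b j. S = {Pvar a i, Qvar b j}))"
  using assms(3)
proof (induction rule: corr.induct)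
  case corr_zero
  show "0 = bilin_eval \<psi> \<phi> 0 \<and> (\<forall>S. (0 :: 'a gfun) S \<noteq> 0 \<longrightarrow> (\<exists>a i b j. S = {Pvar a i, Qvar b j}))"
    by (simp add: bilin_eval_def)
next
  case (corr_step r g \<gamma> c F)
  obtain a i b j where gen: "g = (Dx ^^ i) (\<psi> a) * (Dx ^^ j) (\<phi> b)" "\<gamma> = pvar a i \<bullet>\<^sub>g qvar b j"
    using corr_step(2) by (auto simp: bilin_gens_def)
  have IH: "c = bilin_eval \<psi> \<phi> F" "\<And>S. F S \<noteq> 0 \<Longrightarrow> \<exists>a i b j. S = {Pvar a i, Qvar b j}"
    using corr_step(4) by blast+
  have "F \<in> fin_gfuns"
    using corr_smooth_finite [OF tDx_closed_bilin_gens [OF assms(1,2)] corr_step(3)] by blast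
  then have "r * g + c = bilin_eval \<psi> \<phi> (smul r \<gamma> + F)"
    using corr_step(1)
    by (simp only: bilin_eval_add smul_in_fin_gfuns pvar_gmul_qvar_in_fin_gfuns bilin_eval_gen gen IH(1))
  moreover have "\<exists>a i b j. S = {Pvar a i, Qvar b j}" if "(smul r \<gamma> + F) S \<noteq> 0" for S
  proof (cases "F S = 0")
    case True
    with that have "S = {Pvar a i, Qvar b j}"
      by (auto simp: gen(2) smul_def pvar_gmul_qvar split: if_splits)
    then show ?thesis
      by blast
  qed (rule IH(2))
  ultimately show "r * g + c = bilin_eval \<psi> \<phi> (smul r \<gamma> + F) \<and>
      (\<forall>S. (smul r \<gamma> + F) S \<noteq> 0 \<longrightarrow> (\<exists>a i b j. S = {Pvar a i, Qvar b j}))"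
    by blast
qed

lemma sum_fun_apply: "sum F J x = (\<Sum>y\<in>J. F y x)"
  using sum_comp_morphism [of "\<lambda>f. f x" F J] by (simp add: comp_def)

text \<open>Products pq are basis monomials with sign \<open>+1\<close>, and distinct indices give
  distinct monomials, so rebuilding the function from its coefficients meets no sign and no
  overlap.\<close>

lemma bidiff_fun_eq:
  assumes "F l \<in> fin_gfuns" and supp: "\<And>S. F l S \<noteq> 0 \<Longrightarrow> \<exists>a i b j. S = {Pvar a i, Qvar b j}"
  shows "bidiff_fun (\<lambda>l a b i j. F l {Pvar a i, Qvar b j}) l = F l"
proof
  fix S
  let ?J = "{(a, b, i, j). F l {Pvar a i, Qvar b j} \<noteq> 0}"
  let ?t = "\<lambda>(a, b, i, j). smul (F l {Pvar a i, Qvar b j}) (pvar a i \<bullet>\<^sub>g qvar b j)"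
  have J: "finite ?J"
    by (rule finite_bilin_coeffs) fact
  have "bidiff_fun (\<lambda>l a b i j. F l {Pvar a i, Qvar b j}) l = Sum_any ?t"
    unfolding bidiff_fun_def gconst_gmul_gen gmul_smul_left ..
  also have "\<dots> = sum ?t ?J"
    using J by (rule Sum_any.expand_superset) auto
  finally have eq: "bidiff_fun (\<lambda>l a b i j. F l {Pvar a i, Qvar b j}) l S = (\<Sum>x\<in>?J. ?t x S)"
    by (simp only: sum_fun_apply)
  show "bidiff_fun (\<lambda>l a b i j. F l {Pvar a i, Qvar b j}) l S = F l S"
  proof (cases "F l S = 0")
    case True
    then have "?t x S = 0" for x
      by (auto simp: smul_def pvar_gmul_qvar case_prod_unfold)
    with True show ?thesis
      unfolding eq by simp
  next
    case False
    then obtain a i b j where S: "S = {Pvar a i, Qvar b j}"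
      using supp by blast
    then have "(\<Sum>x\<in>?J. ?t x S) = (\<Sum>x\<in>{(a, b, i, j)}. ?t x S)"
      using J False by (intro sum.mono_neutral_right) (auto simp: smul_def pvar_gmul_qvar doubleton_eq)
    with S show ?thesis
      unfolding eq by (simp add: smul_def pvar_gmul_qvar)
  qed
qed

section \<open>Uniqueness of coefficients\<close>

text \<open>The base point is a parameter because the coefficients at \<open>z\<close> are extracted
  with \<open>x0 = z Xc\<close>. Depending on x alone, these functions have their ordinary
  derivative as \<open>Dx\<close>.\<close>

definition taylor_fn :: "real \<Rightarrow> nat \<Rightarrow> 'm fn" where
  "taylor_fn x0 n = (\<lambda>z. (z Xc - x0) ^ n / fact n)"

lemma taylor_fn_in_smooth_fns: "(taylor_fn x0 n :: 'a fn) \<in> smooth_fns"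
proof -
  have pow: "((\<lambda>z. z Xc) + (\<lambda>_. - x0)) ^ n = (\<lambda>z. (z Xc - x0) ^ n :: real)"
    by (induction n) (simp_all add: fun_eq_iff)
  have "(\<lambda>_. 1 / fact n) * ((\<lambda>z. z Xc) + (\<lambda>_. - x0)) ^ n \<in> (smooth_fns :: 'a fn set)"
    by (intro smooth_intros coord_in_smooth_fns)
  moreover have "(\<lambda>_. 1 / fact n) * ((\<lambda>z. z Xc) + (\<lambda>_. - x0)) ^ n = (taylor_fn x0 n :: 'a fn)"
    unfolding pow by (simp add: taylor_fn_def fun_eq_iff)
  ultimately show ?thesis
    by (simp only:)
qed

lemma Dx_taylor_fn: "Dx (taylor_fn x0 n :: 'a fn) = (case n of 0 \<Rightarrow> 0 | Suc m \<Rightarrow> taylor_fn x0 m)"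
proof -
  have "pd (Uc j k) (taylor_fn x0 n :: 'a fn) = 0" for j k
    by (rule pd_eqI) (simp add: taylor_fn_def)
  then have "Dx (taylor_fn x0 n :: 'a fn) = pd Xc (taylor_fn x0 n)"
    by (subst Dx_eq_sum [of "{}"]) auto
  also have "\<dots> = (case n of 0 \<Rightarrow> 0 | Suc m \<Rightarrow> taylor_fn x0 m)"
  proof (rule pd_eqI)
    fix z :: "'a point"
    show "((\<lambda>s. taylor_fn x0 n (z(Xc := s))) has_real_derivative
        (case n of 0 \<Rightarrow> 0 | Suc m \<Rightarrow> taylor_fn x0 m) z) (at (z Xc))"
    proof (cases n)
      case (Suc m)
      have "((\<lambda>s. (s - x0) ^ Suc m / fact (Suc m)) has_real_derivative
          real (Suc m) * (z Xc - x0) ^ m / fact (Suc m)) (at (z Xc))"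
        by (auto intro!: derivative_eq_intros simp del: fact_Suc power_Suc of_nat_Suc)
      moreover have "real (Suc m) * (z Xc - x0) ^ m / fact (Suc m) = (z Xc - x0) ^ m / fact m"
        by (simp del: of_nat_Suc)
      ultimately show ?thesis
        by (simp add: Suc taylor_fn_def del: fact_Suc power_Suc of_nat_Suc)
    qed (simp add: taylor_fn_def)
  qed
  finally show ?thesis .
qed

lemma Dx_funpow_taylor_fn:
  "(Dx ^^ k) (taylor_fn x0 n :: 'a fn) = (if k \<le> n then taylor_fn x0 (n - k) else 0)"
proof (induction k)
  case (Suc k)
  then have "(Dx ^^ Suc k) (taylor_fn x0 n :: 'a fn) = Dx (if k \<le> n then taylor_fn x0 (n - k) else 0)"
    by (simp only: funpow.simps comp_apply)
  also have "\<dots> = (if Suc k \<le> n then taylor_fn x0 (n - Suc k) else 0)"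
  proof (cases "Suc k \<le> n")
    case True
    then have "n - k = Suc (n - Suc k)"
      by simp
    with True show ?thesis
      by (simp only: Dx_taylor_fn Suc_leD if_True nat.case)
  next
    case False
    \<comment> \<open>Truncated subtraction covers both \<open>k = n\<close>, where the constant 1
      is differentiated, and \<open>k > n\<close>.\<close>
    then have "n - k = 0"
      by simp
    with False show ?thesis
      by (simp add: Dx_taylor_fn)
  qed
  finally show "(Dx ^^ Suc k) (taylor_fn x0 n :: 'a fn) = (if Suc k \<le> n then taylor_fn x0 (n - Suc k) else 0)" .
qed simp

lemma Dx_funpow_taylor_fn_at: "(Dx ^^ k) (taylor_fn (z Xc) n) z = (if k = n then 1 else 0)"
  unfolding Dx_funpow_taylor_fn by (simp add: taylor_fn_def)

lemma Dx_funpow_zero: "(Dx ^^ k) 0 = 0"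
  by (induction k) (simp_all only: funpow.simps comp_apply id_apply Dx_zero)

text \<open>Each test tuple has one nonzero component whose derivatives at \<open>z\<close> form a
  Kronecker delta, so all terms of the operator but one vanish there.\<close>

lemma bidiff_app_test_tuples:
  fixes c :: "('m::finite) bidiff"
  assumes "c \<in> bidiff_ops"
  shows "bidiff_app c (\<lambda>a'. if a' = a then taylor_fn (z Xc) i else 0)
    (\<lambda>b'. if b' = b then taylor_fn (z Xc) j else 0) l z = c l a b i j z"
proof -
  let ?\<psi> = "\<lambda>a'. if a' = a then taylor_fn (z Xc) i else 0"
  let ?\<phi> = "\<lambda>b'. if b' = b then taylor_fn (z Xc) j else 0"
  let ?t = "\<lambda>(a', b', i', j'). c l a' b' i' j' * (Dx ^^ i') (?\<psi> a') * (Dx ^^ j') (?\<phi> b')"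
  \<comment> \<open>\<open>(a, b, i, j)\<close> is inserted so that the sum contains its term even
    if that coefficient is zero.\<close>
  let ?J = "insert (a, b, i, j) (\<Union>a. \<Union>b. (\<lambda>(i, j). (a, b, i, j)) ` {(i, j). c l a b i j \<noteq> 0})"
  have J: "finite ?J"
    using assms by (simp add: bidiff_ops_def)
  have "bidiff_app c ?\<psi> ?\<phi> l = sum ?t ?J"
    unfolding bidiff_app_def using J
  proof (rule Sum_any.expand_superset)
    show "{x. ?t x \<noteq> 0} \<subseteq> ?J"
      by (auto simp: image_iff)
  qed
  then have "bidiff_app c ?\<psi> ?\<phi> l z = (\<Sum>x\<in>?J. ?t x z)"
    by (simp only: sum_fun_apply)
  also have "\<dots> = (\<Sum>x\<in>{(a, b, i, j)}. ?t x z)"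
  proof (rule sum.mono_neutral_right [OF J])
    show "\<forall>x\<in>?J - {(a, b, i, j)}. ?t x z = 0"
    proof
      fix x
      assume "x \<in> ?J - {(a, b, i, j)}"
      then show "?t x z = 0"
        by (cases x) (auto simp: Dx_funpow_zero Dx_funpow_taylor_fn_at)
    qed
  qed simp
  finally show ?thesis
    by (simp add: Dx_funpow_taylor_fn_at)
qed

lemma has_coeffs_unique:
  fixes c d :: "('m::finite) bidiff"
  assumes "has_coeffs B c" "has_coeffs B d"
  shows "c = d"
proof -
  have "c l a b i j z = d l a b i j z" for l a b i j z
  proof -
    \<comment> \<open>The test tuples depend on the point, so the coefficients are compared one
      point at a time.\<close>
    let ?\<psi> = "\<lambda>a'. if a' = a then taylor_fn (z Xc) i else 0"
    let ?\<phi> = "\<lambda>b'. if b' = b then taylor_fn (z Xc) j else 0"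
    have "?\<psi> \<in> tuples" "?\<phi> \<in> tuples"
      by (auto simp: tuples_def taylor_fn_in_smooth_fns zero_in_smooth_fns)
    then have "bidiff_app c ?\<psi> ?\<phi> = bidiff_app d ?\<psi> ?\<phi>"
      using assms unfolding has_coeffs_def by metis
    then show ?thesis
      using assms bidiff_app_test_tuples [of c a z i b j l] bidiff_app_test_tuples [of d a z i b j l]
      by (simp add: has_coeffs_def)
  qed
  then show ?thesis
    by (intro ext)
qed

section \<open>Equality of the bracket with the function of the operator\<close>

theorem theorem11:
  fixes f :: "('m::{finite,linorder}) \<Rightarrow> 'm fn"
    and A R :: "'m cdiff"
  assumes "f \<in> tuples"
    and "A \<in> cdiff_ops" and "adj A = - A" and "is_shadow f (H_fun A)"
    and "R \<in> cdiff_ops" and "is_shadow f (N_fun R)"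
  shows "(\<exists>!c. has_coeffs (Cstar A R) c) \<and> bracket A R = corresponding_fun (Cstar A R)"
proof -
  \<comment> \<open>The candidate coefficients of the operator are those of the bracket at the
    monomials pq.\<close>
  let ?F = "bracket A R" and ?c = "\<lambda>l a b i j. bracket A R l {Pvar a i, Qvar b j}"
  have corr: "corr (bilin_gens \<psi> \<phi>) (Cstar A R \<psi> \<phi> l) (?F l)"
    if "\<psi> \<in> tuples" "\<phi> \<in> tuples" for \<psi> \<phi> l
    using assms that by (intro corr_bracket)
  \<comment> \<open>Finiteness and support are properties of the bracket itself, so they may be
    obtained from the correspondence at the zero tuples.\<close>
  have zero: "0 \<in> tuples"
    by (simp add: tuples_def zero_in_smooth_fns)
  have F: "?F l \<in> fin_gfuns" for l
    using corr_smooth_finite [OF tDx_closed_bilin_gens corr] zero by blast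
  have supp: "\<exists>a i b j. S = {Pvar a i, Qvar b j}" if "?F l S \<noteq> 0" for l S
    using corr_bilin_gens [OF zero zero corr [OF zero zero]] that by blast
  have "?c \<in> bidiff_ops"
  proof -
    have "finite {(i, j). ?F l {Pvar a i, Qvar b j} \<noteq> 0}" for l a b
    proof -
      have "inj (\<lambda>(i, j). (a, b, i :: nat, j :: nat))"
        by (auto simp: inj_def)
      from finite_vimageI [OF finite_bilin_coeffs [OF F] this] show ?thesis
        by (simp add: vimage_def case_prod_unfold)
    qed
    then show ?thesis
      using F by (simp add: bidiff_ops_def fin_gfuns_def)
  qed
  moreover have "Cstar A R \<psi> \<phi> = bidiff_app ?c \<psi> \<phi>" if "\<psi> \<in> tuples" "\<phi> \<in> tuples" for \<psi> \<phi>
  proof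
    fix l
    show "Cstar A R \<psi> \<phi> l = bidiff_app ?c \<psi> \<phi> l"
      using corr_bilin_gens [OF that corr [OF that]] by (simp add: bidiff_app_def bilin_eval_def)
  qed
  ultimately have c: "has_coeffs (Cstar A R) ?c"
    by (simp add: has_coeffs_def)
  then have unique: "\<exists>!c. has_coeffs (Cstar A R) c"
    using has_coeffs_unique by blast
  \<comment> \<open>Uniqueness identifies the definite description in
    \<open>corresponding_fun\<close> with \<open>?c\<close>, from which \<open>bidiff_fun_eq\<close>
    rebuilds the bracket.\<close>
  moreover have "(THE c. has_coeffs (Cstar A R) c) = ?c"
    using c has_coeffs_unique by blast
  then have "corresponding_fun (Cstar A R) l = ?F l" for l
    unfolding corresponding_fun_def using bidiff_fun_eq [of ?F l, OF F supp] by (simp only:)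
  then have "bracket A R = corresponding_fun (Cstar A R)"
    by (intro ext) (simp only:)
  ultimately show ?thesis
    by blast
qed

end
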